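(* Let $(\mathcal{E},R,\langle\cdot,\cdot\rangle,\partial,\circ)$ be a Courant-Dorfman algebra over $\mathfrak{k}$, let $\mathcal{H}\subseteq\mathcal{E}$ be an $R$-submodule containing $\partial R$ which is an isotropic ideal of $\mathcal{E}$, and let $(\mathcal{V},\nabla)$ be an $\mathcal{H}$-representation of $\mathcal{E}$. Then $C^{\bullet}(\mathcal{E},\mathcal{H},\mathcal{V})=\bigoplus_{n}C^{n}(\mathcal{E},\mathcal{H},\mathcal{V})$ is a cochain complex under $d=d_{0}+\delta+d'$; that is, $d$ maps $C^{n}(\mathcal{E},\mathcal{H},\mathcal{V})$ into $C^{n+1}(\mathcal{E},\mathcal{H},\mathcal{V})$ for every $n\ge 0$, and $d\circ d=0$.
   Context: Throughout $\mathfrak{k}=\mathbb{R}$ or $\mathbb{C}$; unadorned tensor products are over $\mathfrak{k}$; a hat denotes omission. A Courant-Dorfman algebra $(\mathcal{E},R,\langle\cdot,\cdot\rangle,\partial,\circ)$ consists of a commutative $\mathfrak{k}$-algebra $R$, an $R$-module $\mathcal{E}$, a symmetric $R$-bilinear form $\langle\cdot,\cdot\rangle:\mathcal{E}\otimes_R\mathcal{E}\to R$ (not assumed non-degenerate), a derivation $\partial:R\to\mathcal{E}$ and a $\mathfrak{k}$-bilinear bracket $\circ:\mathcal{E}\otimes\mathcal{E}\to\mathcal{E}$ such that for all $e,e_i\in\mathcal{E}$, $f,g\in R$: (1) $e_1\circ(fe_2)=f(e_1\circ e_2)+\langle e_1,\partial f\rangle e_2$; (2) $\langle e_1,\partial\langle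 e_2,e_3\rangle\rangle=\langle e_1\circ e_2,e_3\rangle+\langle e_2,e_1\circ e_3\rangle$; (3) $e_1\circ e_2+e_2\circ e_1=\partial\langle e_1,e_2\rangle$; (4) $e_1\circ(e_2\circ e_3)=(e_1\circ e_2)\circ e_3+e_2\circ(e_1\circ e_3)$; (5) $\partial f\circ e=0$; (6) $\langle\partial f,\partial g\rangle=0$. The anchor is $\rho(e)f=\langle e,\partial f\rangle$. Isotropic ideal: $\langle\alpha,\beta\rangle=0$ for $\alpha,\beta\in\mathcal{H}$, and $e\circ\alpha,\ \alpha\circ e\in\mathcal{H}$ for $e\in\mathcal{E},\alpha\in\mathcal{H}$. An $\mathcal{H}$-representation of $\mathcal{E}$ is an $R$-module $\mathcal{V}$ with a $\mathfrak{k}$-linear map $e\mapsto\nabla_e$ from $\mathcal{E}$ to $\mathfrak{k}$-linear endomorphisms of $\mathcal{V}$ with $\nabla_{e_1\circ e_2}=\nabla_{e_1}\nabla_{e_2}-\nabla_{e_2}\nabla_{e_1}$, $\nabla_\alpha v=0$, $\nabla_{fe}v=f\nabla_ev$, $\nabla_e(fv)=(\rho(e)f)v+f\nabla_ev$ for $\alpha\in\mathcal{H}$, $e,e_1,e_2\in\mathcal{E}$, $f\in R$, $v\in\mathcal{V}$. $C^n(\mathcal{E},\mathcal{H},\mathcal{V})$ is the space of sequences $\omega=(\omega_0,\dots,\omega_{[n/2]})$ of $\mathfrak{k}$-linear maps $\omega_k:(\otimes^{n-2k}\mathcal{E})\otimes(\odot^k\mathcal{H})\to\mathcal{V}$ ($\odot^k$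 the symmetric power over $\mathfrak{k}$; set $\omega_k=0$ for $k>[n/2]$ or $k<0$) such that for all $k$: 1) $\omega_k(e_1,\dots,e_a,e_{a+1},\dots,e_{n-2k};\alpha_1,\dots,\alpha_k)+\omega_k(e_1,\dots,e_{a+1},e_a,\dots,e_{n-2k};\alpha_1,\dots,\alpha_k)=-\omega_{k+1}(e_1,\dots,\widehat{e_a},\widehat{e_{a+1}},\dots,e_{n-2k};\partial\langle e_a,e_{a+1}\rangle,\alpha_1,\dots,\alpha_k)$; 2) $\omega_k(e_1,\dots,fe_a,\dots,e_{n-2k};\alpha_1,\dots,\alpha_k)=f\omega_k(e_1,\dots,e_a,\dots,e_{n-2k};\alpha_1,\dots,\alpha_k)+\sum_{b>a}(-1)^{b-a}\langle e_a,e_b\rangle\,\omega_{k+1}(e_1,\dots,\widehat{e_a},\dots,\widehat{e_b},\dots,e_{n-2k};\partial f,\alpha_1,\dots,\alpha_k)$; 3) $\omega_k$ is $R$-linear in each argument from $\mathcal{H}$. For $\omega\in C^n(\mathcal{E},\mathcal{H},\mathcal{V})$ and $0\le k\le[(n+1)/2]$: $(d_0\omega)_k(e_1,\dots,e_{n+1-2k};\alpha_1,\dots,\alpha_k)=\sum_a(-1)^{a+1}\nabla_{e_a}\omega_k(\dots,\widehat{e_a},\dots;\alpha_1,\dots,\alpha_k)+\sum_{a<b}(-1)^a\omega_k(\dots,\widehat{e_a},\dots,e_a\circ e_b,\dots;\alpha_1,\dots,\alpha_k)$, with $e_a\circ e_b$ in the place of $e_b$ (the Leibniz coboundary with coefficients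 in $(\mathcal{V},\nabla,-\nabla)$); $(\delta\omega)_k(e_1,\dots,e_{n+1-2k};\alpha_1,\dots,\alpha_k)=\sum_i\omega_{k-1}(\alpha_i,e_1,\dots,e_{n+1-2k};\alpha_1,\dots,\widehat{\alpha_i},\dots,\alpha_k)$ (zero for $k=0$); $(d'\omega)_k(e_1,\dots,e_{n+1-2k};\alpha_1,\dots,\alpha_k)=\sum_{a,i}(-1)^{a+1}\omega_k(\dots,\widehat{e_a},\dots;\alpha_1,\dots,\widehat{\alpha_i},\alpha_i\circ e_a,\dots,\alpha_k)$, with $\alpha_i\circ e_a$ in the place of $\alpha_i$. *)

theory Defs
  imports Complex_Main "HOL-Library.Function_Algebras" "HOL-Library.Multiset"
begin

text \<open>The ground field is \<open>\<real>\<close> or \<open>\<complex>\<close>, up to an isomorphism of fields.\<close>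

class real_or_complex = field +
  assumes real_or_complex:
    "(\<exists>\<phi> :: 'a \<Rightarrow> real. bij \<phi> \<and> (\<forall>x y. \<phi> (x + y) = \<phi> x + \<phi> y) \<and> (\<forall>x y. \<phi> (x * y) = \<phi> x * \<phi> y)) \<or>
     (\<exists>\<phi> :: 'a \<Rightarrow> complex. bij \<phi> \<and> (\<forall>x y. \<phi> (x + y) = \<phi> x + \<phi> y) \<and> (\<forall>x y. \<phi> (x * y) = \<phi> x * \<phi> y))"

instance real :: real_or_complex
  by standard (rule disjI1, rule exI[of _ "\<lambda>x. x"], auto simp: bij_def)

instance complex :: real_or_complex
  by standard (rule disjI2, rule exI[of _ "\<lambda>x. x"], auto simp: bij_def)

locale commutative_algebra = vector_space scale
  for scale :: "'k::field \<Rightarrow> 'r::comm_ring_1 \<Rightarrow> 'r" +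
  assumes scale_mult_left: "scale c (f * g) = scale c f * g"

text \<open>
  An \<open>R\<close>-module is a vector space over the ground field through the structure map
  \<open>c \<mapsto> c \<cdot> 1\<close> of the algebra \<open>R\<close>; this is the ground field action meant throughout.
\<close>

definition ground_scale ::
  "('k::field \<Rightarrow> 'r::comm_ring_1 \<Rightarrow> 'r) \<Rightarrow> ('r \<Rightarrow> 'm::ab_group_add \<Rightarrow> 'm) \<Rightarrow> 'k \<Rightarrow> 'm \<Rightarrow> 'm" where
  "ground_scale scale smult c x = smult (scale c 1) x"

lemma vector_space_ground_scale:
  assumes "commutative_algebra scale" and "module smult"
  shows "vector_space (ground_scale scale smult)"
proof -
  interpret R: commutative_algebra scale by fact
  interpret M: module smult by fact
  have "scale a 1 * scale b 1 = scale (a * b) 1" for a b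
    by (metis R.scale_mult_left R.scale_scale mult_1)
  then show ?thesis
    by unfold_locales
      (simp_all add: ground_scale_def M.scale_right_distrib M.scale_left_distrib
        R.scale_left_distrib)
qed

locale courant_dorfman_algebra =
  R: commutative_algebra scale + E: module smult
  for scale :: "'k::real_or_complex \<Rightarrow> 'r::comm_ring_1 \<Rightarrow> 'r"
    and smult :: "'r \<Rightarrow> 'e::ab_group_add \<Rightarrow> 'e" +
  fixes ip :: "'e \<Rightarrow> 'e \<Rightarrow> 'r"
    and der :: "'r \<Rightarrow> 'e"
    and br :: "'e \<Rightarrow> 'e \<Rightarrow> 'e"
  assumes ip_sym: "ip x y = ip y x"
    and ip_linear: "module_hom smult (*) (ip x)"
    and der_linear: "Vector_Spaces.linear scale (ground_scale scale smult) der"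
    and der_mult: "der (f * g) = smult f (der g) + smult g (der f)"
    and br_linear_left: "Vector_Spaces.linear (ground_scale scale smult) (ground_scale scale smult) (\<lambda>x. br x y)"
    and br_linear_right: "Vector_Spaces.linear (ground_scale scale smult) (ground_scale scale smult) (br x)"
    and br_smult: "br x (smult f y) = smult f (br x y) + smult (ip x (der f)) y"
    and br_ip: "ip x (der (ip y z)) = ip (br x y) z + ip y (br x z)"
    and br_sym: "br x y + br y x = der (ip x y)"
    and br_leibniz: "br x (br y z) = br (br x y) z + br y (br x z)"
    and br_der: "br (der f) x = 0"
    and ip_der_der: "ip (der f) (der g) = 0"

definition isotropic_ideal ::
  "('e \<Rightarrow> 'e \<Rightarrow> 'r::zero) \<Rightarrow> ('e \<Rightarrow> 'e \<Rightarrow> 'e) \<Rightarrow> 'e set \<Rightarrow> bool" where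
  "isotropic_ideal ip br H \<longleftrightarrow>
     (\<forall>\<alpha>\<in>H. \<forall>\<beta>\<in>H. ip \<alpha> \<beta> = 0) \<and> (\<forall>e. \<forall>\<alpha>\<in>H. br e \<alpha> \<in> H \<and> br \<alpha> e \<in> H)"

locale H_representation =
  courant_dorfman_algebra scale smult ip der br + V: module vmult
  for scale :: "'k::real_or_complex \<Rightarrow> 'r::comm_ring_1 \<Rightarrow> 'r"
    and smult :: "'r \<Rightarrow> 'e::ab_group_add \<Rightarrow> 'e"
    and ip der br
    and H :: "'e set"
    and vmult :: "'r \<Rightarrow> 'v::ab_group_add \<Rightarrow> 'v" +
  fixes nabla :: "'e \<Rightarrow> 'v \<Rightarrow> 'v"
  assumes nabla_linear_left: "Vector_Spaces.linear (ground_scale scale smult) (ground_scale scale vmult) (\<lambda>x. nabla x v)"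
    and nabla_linear_right: "Vector_Spaces.linear (ground_scale scale vmult) (ground_scale scale vmult) (nabla x)"
    and nabla_br: "nabla (br x y) v = nabla x (nabla y v) - nabla y (nabla x v)"
    and nabla_H: "\<alpha> \<in> H \<Longrightarrow> nabla \<alpha> v = 0"
    and nabla_smult: "nabla (smult f x) v = vmult f (nabla x v)"
    and nabla_vmult: "nabla x (vmult f v) = vmult (ip x (der f)) v + vmult f (nabla x v)"

text \<open>
  A sequence of linear maps \<open>\<omega>\<^sub>k\<close> on \<open>(\<otimes>\<^bsup>n-2k\<^esup> E) \<otimes> (\<odot>\<^bsup>k\<^esup> H)\<close> is encoded as a function
  \<open>\<omega> k es \<alpha>s\<close>, where the lists \<open>es\<close> and \<open>\<alpha>s\<close> hold the arguments from \<open>E\<close> and from \<open>H\<close>: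
  it is multilinear over the ground field and symmetric in \<open>\<alpha>s\<close>.
  Outside the intended domain the value is \<open>0\<close>, so that equality of cochains is equality of
  functions. Positions in lists are counted from \<open>0\<close>, and \<open>nths es (- {a, b})\<close> is the list
  \<open>es\<close> with the entries at the positions \<open>a\<close> and \<open>b\<close> omitted.
\<close>

type_synonym ('e, 'v) cochain = "nat \<Rightarrow> 'e list \<Rightarrow> 'e list \<Rightarrow> 'v"

definition args :: "'e set \<Rightarrow> nat \<Rightarrow> nat \<Rightarrow> ('e list \<times> 'e list) set" where
  "args H n k = {(es, \<alpha>s). 2 * k + length es = n \<and> length \<alpha>s = k \<and> set \<alpha>s \<subseteq> H}"

definition symmetric_multilinear ::
  "('k::field \<Rightarrow> 'r::comm_ring_1 \<Rightarrow> 'r) \<Rightarrow> ('r \<Rightarrow> 'e::ab_group_add \<Rightarrow> 'e) \<Rightarrow>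
   ('r \<Rightarrow> 'v::ab_group_add \<Rightarrow> 'v) \<Rightarrow> 'e set \<Rightarrow> nat \<Rightarrow> ('e, 'v) cochain \<Rightarrow> bool" where
  "symmetric_multilinear scale smult vmult H n \<omega> \<longleftrightarrow>
     (\<forall>k es \<alpha>s. (es, \<alpha>s) \<notin> args H n k \<longrightarrow> \<omega> k es \<alpha>s = 0) \<and>
     (\<forall>k. \<forall>(es, \<alpha>s) \<in> args H n k.
        (\<forall>a<length es. Vector_Spaces.linear (ground_scale scale smult) (ground_scale scale vmult)
           (\<lambda>x. \<omega> k (es[a := x]) \<alpha>s)) \<and>
        (\<forall>i<k. \<forall>x\<in>H. \<forall>y\<in>H. \<omega> k es (\<alpha>s[i := x + y]) = \<omega> k es (\<alpha>s[i := x]) + \<omega> k es (\<alpha>s[i := y])) \<and>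
        (\<forall>i<k. \<forall>x\<in>H. \<forall>c. \<omega> k es (\<alpha>s[i := ground_scale scale smult c x]) =
           ground_scale scale vmult c (\<omega> k es (\<alpha>s[i := x]))) \<and>
        (\<forall>\<beta>s. mset \<beta>s = mset \<alpha>s \<longrightarrow> \<omega> k es \<beta>s = \<omega> k es \<alpha>s))"

definition cochains ::
  "('k::field \<Rightarrow> 'r::comm_ring_1 \<Rightarrow> 'r) \<Rightarrow> ('r \<Rightarrow> 'e::ab_group_add \<Rightarrow> 'e) \<Rightarrow>
   ('e \<Rightarrow> 'e \<Rightarrow> 'r) \<Rightarrow> ('r \<Rightarrow> 'e) \<Rightarrow> 'e set \<Rightarrow> ('r \<Rightarrow> 'v::ab_group_add \<Rightarrow> 'v) \<Rightarrow>
   nat \<Rightarrow> ('e, 'v) cochain set" where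
  "cochains scale smult ip der H vmult n =
     {\<omega>. symmetric_multilinear scale smult vmult H n \<omega> \<and>
       (\<forall>k. \<forall>(es, \<alpha>s) \<in> args H n k.
          (\<forall>a. Suc a < length es \<longrightarrow>
             \<omega> k es \<alpha>s + \<omega> k (es[a := es ! Suc a, Suc a := es ! a]) \<alpha>s =
             - \<omega> (Suc k) (nths es (- {a, Suc a})) (der (ip (es ! a) (es ! Suc a)) # \<alpha>s)) \<and>
          (\<forall>a<length es. \<forall>f.
             \<omega> k (es[a := smult f (es ! a)]) \<alpha>s =
             vmult f (\<omega> k es \<alpha>s) +
             (\<Sum>b\<in>{a<..<length es}. vmult ((-1) ^ (b - a) * ip (es ! a) (es ! b))
                (\<omega> (Suc k) (nths es (- {a, b})) (der f # \<alpha>s)))) \<and>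
          (\<forall>i<k. \<forall>f. \<omega> k es (\<alpha>s[i := smult f (\<alpha>s ! i)]) = vmult f (\<omega> k es \<alpha>s)))}"

text \<open>
  Because positions are counted from \<open>0\<close>, the sign \<open>(-1)\<^bsup>a+1\<^esup>\<close> of the formulas with positions
  counted from \<open>1\<close> becomes \<open>(-1)\<^bsup>a\<^esup>\<close>, and \<open>(-1)\<^bsup>a\<^esup>\<close> becomes \<open>(-1)\<^bsup>a+1\<^esup>\<close>.
\<close>

definition d_Leibniz ::
  "('e \<Rightarrow> 'e \<Rightarrow> 'e) \<Rightarrow> ('r::comm_ring_1 \<Rightarrow> 'v::ab_group_add \<Rightarrow> 'v) \<Rightarrow> ('e \<Rightarrow> 'v \<Rightarrow> 'v) \<Rightarrow>
   ('e, 'v) cochain \<Rightarrow> ('e, 'v) cochain" where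
  "d_Leibniz br vmult nabla \<omega> k es \<alpha>s =
     (\<Sum>a<length es. vmult ((-1) ^ a) (nabla (es ! a) (\<omega> k (nths es (- {a})) \<alpha>s))) +
     (\<Sum>b<length es. \<Sum>a<b. vmult ((-1) ^ Suc a)
        (\<omega> k (nths (es[b := br (es ! a) (es ! b)]) (- {a})) \<alpha>s))"

definition d_delta :: "('e, 'v::ab_group_add) cochain \<Rightarrow> ('e, 'v) cochain" where
  "d_delta \<omega> k es \<alpha>s =
     (if k = 0 then 0
      else \<Sum>i<length \<alpha>s. \<omega> (k - 1) (\<alpha>s ! i # es) (nths \<alpha>s (- {i})))"

definition d_prime ::
  "('e \<Rightarrow> 'e \<Rightarrow> 'e) \<Rightarrow> ('r::comm_ring_1 \<Rightarrow> 'v::ab_group_add \<Rightarrow> 'v) \<Rightarrow>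
   ('e, 'v) cochain \<Rightarrow> ('e, 'v) cochain" where
  "d_prime br vmult \<omega> k es \<alpha>s =
     (\<Sum>a<length es. \<Sum>i<length \<alpha>s. vmult ((-1) ^ a)
        (\<omega> k (nths es (- {a})) (\<alpha>s[i := br (\<alpha>s ! i) (es ! a)])))"

text \<open>
  For \<open>\<omega>\<close> of degree \<open>n\<close> the three formulas vanish by themselves unless
  \<open>2 * k + length es = n + 1\<close> and \<open>length \<alpha>s = k\<close>; only the restriction of the last arguments
  to \<open>H\<close> has to be enforced, and the degree is not needed as a parameter.
\<close>

definition differential ::
  "('e \<Rightarrow> 'e \<Rightarrow> 'e) \<Rightarrow> 'e set \<Rightarrow> ('r::comm_ring_1 \<Rightarrow> 'v::ab_group_add \<Rightarrow> 'v) \<Rightarrow>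
   ('e \<Rightarrow> 'v \<Rightarrow> 'v) \<Rightarrow> ('e, 'v) cochain \<Rightarrow> ('e, 'v) cochain" where
  "differential br H vmult nabla \<omega> k es \<alpha>s =
     (if set \<alpha>s \<subseteq> H
      then d_Leibniz br vmult nabla \<omega> k es \<alpha>s + d_delta \<omega> k es \<alpha>s + d_prime br vmult \<omega> k es \<alpha>s
      else 0)"

definition cochain_scale ::
  "('k::field \<Rightarrow> 'r::comm_ring_1 \<Rightarrow> 'r) \<Rightarrow> ('r \<Rightarrow> 'v::ab_group_add \<Rightarrow> 'v) \<Rightarrow>
   'k \<Rightarrow> ('e, 'v) cochain \<Rightarrow> ('e, 'v) cochain" where
  "cochain_scale scale vmult c \<omega> = (\<lambda>k es \<alpha>s. ground_scale scale vmult c (\<omega> k es \<alpha>s))"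

text \<open>A cochain complex of subspaces \<open>C n\<close> of one vector space.\<close>

definition cochain_complex ::
  "('k::field \<Rightarrow> 'c::ab_group_add \<Rightarrow> 'c) \<Rightarrow> (nat \<Rightarrow> 'c set) \<Rightarrow> ('c \<Rightarrow> 'c) \<Rightarrow> bool" where
  "cochain_complex s C d \<longleftrightarrow>
     vector_space s \<and>
     (\<forall>n. module.subspace s (C n)) \<and>
     (\<forall>n. \<forall>x\<in>C n. \<forall>y\<in>C n. d (x + y) = d x + d y) \<and>
     (\<forall>n. \<forall>x\<in>C n. \<forall>c. d (s c x) = s c (d x)) \<and>
     (\<forall>n. d ` C n \<subseteq> C (Suc n)) \<and>
     (\<forall>n. \<forall>x\<in>C n. d (d x) = 0)"

end

theory Submission
  imports Defs
begin

text \<open>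
  The proof is a Cartan calculus. Let \<open>\<iota>\<^sub>x\<close> insert \<open>x\<close> as the first argument from \<open>E\<close>,
  let \<open>\<kappa>\<^sub>b\<close> insert \<open>b\<close> as the first argument from \<open>H\<close>, and let \<open>L\<^sub>x\<close> be the natural action of \<open>x\<close> on all
  arguments and on the value. Then \<open>\<iota>\<^sub>x d + d \<iota>\<^sub>x = L\<^sub>x\<close>, while \<open>\<kappa>\<^sub>b d - d \<kappa>\<^sub>b\<close> is \<open>\<iota>\<^sub>b\<close> plus a term
  that vanishes for \<open>b \<in> \<partial>R\<close>. Since \<open>\<iota>\<^sub>x\<close> and \<open>L\<^sub>x\<close> preserve cochains, induction on the number of
  arguments reduces the cochain conditions for \<open>d \<omega>\<close> to its first arguments, where the
  commutation relations settle them. Likewise \<open>[L\<^sub>x, L\<^sub>y] = L\<^bsub>x \<circ> y\<^esub>\<close> gives \<open>[L\<^sub>x, d] = 0\<close>, hence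
  \<open>\<iota>\<^sub>x d\<^sup>2 = d\<^sup>2 \<iota>\<^sub>x\<close>, and \<open>d\<^sup>2 = 0\<close> only has to be checked without arguments from \<open>E\<close>.
\<close>

subsection \<open>Sums over omitted list positions\<close>

lemma nths_Cons_omit:
  "nths (x # xs) (- {0}) = xs"
  "nths (x # xs) (- {Suc i}) = x # nths xs (- {i})"
proof -
  have "{j. Suc j \<in> - {0}} = UNIV" by auto
  then show "nths (x # xs) (- {0}) = xs"
    by (simp add: nths_Cons nths_all)
  have "{j. Suc j \<in> - {Suc i}} = - {i}" by auto
  then show "nths (x # xs) (- {Suc i}) = x # nths xs (- {i})"
    by (simp add: nths_Cons)
qed

lemma length_nths_omit: "i < length xs \<Longrightarrow> Suc (length (nths xs (- {i}))) = length xs"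
proof (induction xs arbitrary: i)
  case (Cons x xs)
  then show ?case by (cases i) (simp_all only: nths_Cons_omit, auto)
qed simp

text \<open>Splitting the list at the first omitted position reduces a double omission to a single
  one in the tail. The case \<open>b = 0\<close> serves the exchange of neighbouring arguments,
  general \<open>b\<close> the correction sum in the \<open>R\<close>-linearity rule.\<close>

lemma nths_omit2: "nths (p @ x # xs) (- {length p, Suc (length p + b)}) = p @ nths xs (- {b})"
proof (induction p)
  case Nil
  have "{j. Suc j \<in> - {0, Suc b}} = - {b}" by auto
  then show ?case by (simp add: nths_Cons)
next
  case (Cons y p)
  have "{j. Suc j \<in> - {length (y # p), Suc (length (y # p) + b)}} = - {length p, Suc (length p + b)}" by auto
  with Cons.IH show ?case by (simp add: nths_Cons)
qed

lemma mset_nths_omit: "i < length xs \<Longrightarrow> add_mset (xs ! i) (mset (nths xs (- {i}))) = mset xs"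
proof (induction xs arbitrary: i)
  case (Cons x xs)
  then show ?case by (cases i) (simp_all only: nths_Cons_omit, auto)
qed simp

text \<open>For a function symmetric in its list, changing the entry at any position amounts to
  putting the new entry in front of the remaining ones.\<close>

lemma mset_update_omit:
  "i < length xs \<Longrightarrow> mset (xs[i := y]) = mset (y # nths xs (- {i}))"
proof (induction xs arbitrary: i)
  case (Cons x xs)
  then show ?case by (cases i) (simp_all only: nths_Cons_omit list_update.simps mset.simps, auto)
qed simp

text \<open>The common shape of \<open>d_delta\<close> and of the sum over arguments from
  \<open>H\<close> in \<open>d_prime\<close>: one argument is singled out and the others are kept as
  a list.\<close>

definition psum :: "('e \<Rightarrow> 'e list \<Rightarrow> 'v::ab_group_add) \<Rightarrow> 'e list \<Rightarrow> 'v" where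
  "psum F as = (\<Sum>i<length as. F (as ! i) (nths as (- {i})))"

lemma psum_Nil [simp]: "psum F [] = 0"
  by (simp add: psum_def)

lemma psum_Cons: "psum F (b # as) = F b as + psum (\<lambda>a r. F a (b # r)) as"
  unfolding psum_def length_Cons sum.lessThan_Suc_shift by (simp add: nths_Cons_omit)

lemma psum_cong:
  assumes "\<And>a r. a \<in> set as \<Longrightarrow> set r \<subseteq> set as \<Longrightarrow> F a r = G a r"
  shows "psum F as = psum G as"
  unfolding psum_def by (intro sum.cong refl assms) (auto dest: in_set_nthsD)

lemma psum_add: "psum (\<lambda>a r. F a r + G a r) as = psum F as + psum G as"
  by (simp add: psum_def sum.distrib)

lemma psum_diff: "psum (\<lambda>a r. F a r - G a r) as = psum F as - psum G as"
  by (simp add: psum_def sum_subtractf)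

lemma psum_uminus: "psum (\<lambda>a r. - F a r) as = - psum F as"
  by (simp add: psum_def sum_negf)

lemma psum_zero [simp]: "psum (\<lambda>a r. 0) as = 0"
  by (simp add: psum_def)

text \<open>Each summand depends only on the chosen entry and on the multiset of the others, so the
  sum can be rewritten as a sum over the multiset of entries.\<close>

lemma psum_mset:
  assumes sym: "\<And>a r s. mset r = mset s \<Longrightarrow> F a r = F a s"
    and eq: "mset as = mset bs"
  shows "psum F as = psum F bs"
proof -
  \<comment> \<open>A choice of one list for every multiset; by symmetry the remaining arguments may
    be replaced by the chosen list.\<close>
  define c :: "'a multiset \<Rightarrow> 'a list" where "c M = (SOME l. mset l = M)" for M
  have c: "mset (c M) = M" for M
    unfolding c_def by (rule someI_ex) (rule ex_mset)
  have *: "psum F xs = sum_mset (image_mset (\<lambda>a. F a (c (mset xs - {#a#}))) (mset xs))" for xs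
  proof -
    have "F (xs ! i) (nths xs (- {i})) = F (xs ! i) (c (mset xs - {#xs ! i#}))" if "i < length xs" for i
    proof (rule sym)
      have "mset xs - {#xs ! i#} = mset (nths xs (- {i}))"
        by (subst mset_nths_omit[OF that, THEN HOL.sym]) (rule add_mset_remove_trivial)
      then show "mset (nths xs (- {i})) = mset (c (mset xs - {#xs ! i#}))"
        by (simp only: c)
    qed
    then have "psum F xs = (\<Sum>i<length xs. F (xs ! i) (c (mset xs - {#xs ! i#})))"
      unfolding psum_def by (intro sum.cong refl) auto
    also have "\<dots> = sum_list (map (\<lambda>a. F a (c (mset xs - {#a#}))) xs)"
      unfolding sum_list_sum_nth atLeast0LessThan by (intro sum.cong) auto
    also have "\<dots> = sum_mset (mset (map (\<lambda>a. F a (c (mset xs - {#a#}))) xs))"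
      by (rule sum_mset_sum_list[THEN HOL.sym])
    finally show ?thesis unfolding mset_map .
  qed
  show ?thesis unfolding * eq ..
qed

lemma linear_add: "Vector_Spaces.linear s1 s2 f \<Longrightarrow> f (x + y) = f x + f y"
  unfolding Vector_Spaces.linear_def by (blast intro: module_hom.add)

text \<open>
  The index \<open>k\<close> of \<open>\<omega>\<^sub>k\<close> is the length of the list of arguments from \<open>H\<close> and is dropped until the end.
\<close>

definition contract :: "'e \<Rightarrow> ('e list \<Rightarrow> 'e list \<Rightarrow> 'v) \<Rightarrow> 'e list \<Rightarrow> 'e list \<Rightarrow> 'v" where
  "contract x w = (\<lambda>es as. w (x # es) as)"

definition contract_H :: "'e \<Rightarrow> ('e list \<Rightarrow> 'e list \<Rightarrow> 'v) \<Rightarrow> 'e list \<Rightarrow> 'e list \<Rightarrow> 'v" where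
  "contract_H b w = (\<lambda>es as. w es (b # as))"

lemma contract_linear:
  fixes w :: "'e list \<Rightarrow> 'e list \<Rightarrow> 'v::ab_group_add"
  shows "contract x (w + w') = contract x w + contract x w'" "contract x (w - w') = contract x w - contract x w'"
    "contract x (- w) = - contract x w" "contract x 0 = 0"
  by (simp_all add: contract_def fun_eq_iff)

lemma contract_H_linear:
  fixes w :: "'e list \<Rightarrow> 'e list \<Rightarrow> 'v::ab_group_add"
  shows "contract_H x (w + w') = contract_H x w + contract_H x w'" "contract_H x (w - w') = contract_H x w - contract_H x w'"
    "contract_H x (- w) = - contract_H x w" "contract_H x 0 = 0"
  by (simp_all add: contract_H_def fun_eq_iff)

lemma contract_H_contract: "contract_H b (contract x w) = contract x (contract_H b w)"
  by (simp add: contract_def contract_H_def)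

subsection \<open>The algebra of contractions\<close>

locale H_cochains = H_representation scale smult ip der br H vmult nabla
  for scale :: "'k::real_or_complex \<Rightarrow> 'r::comm_ring_1 \<Rightarrow> 'r"
    and smult :: "'r \<Rightarrow> 'e::ab_group_add \<Rightarrow> 'e"
    and ip der br
    and H :: "'e set"
    and vmult :: "'r \<Rightarrow> 'v::ab_group_add \<Rightarrow> 'v"
    and nabla +
  assumes H_subspace: "module.subspace smult H"
    and der_H: "range der \<subseteq> H"
    and H_ideal: "isotropic_ideal ip br H"
begin

section \<open>Consequences of the axioms for pairing, bracket and connection\<close>

lemma H_closed:
  "0 \<in> H" "a \<in> H \<Longrightarrow> b \<in> H \<Longrightarrow> a + b \<in> H" "a \<in> H \<Longrightarrow> smult f a \<in> H" "der f \<in> H"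
  "a \<in> H \<Longrightarrow> br a x \<in> H" "a \<in> H \<Longrightarrow> br x a \<in> H" "a \<in> H \<Longrightarrow> b \<in> H \<Longrightarrow> ip a b = 0"
  using H_subspace der_H H_ideal
  by (auto simp: E.subspace_def isotropic_ideal_def)

lemma nabla_add [simp]: "nabla (x + y) v = nabla x v + nabla y v" "nabla x (u + v) = nabla x u + nabla x v"
  using linear_add[OF nabla_linear_left] linear_add[OF nabla_linear_right] by auto

lemma nabla_additive: "Modules.additive (nabla x)"
  by (simp add: Modules.additive_def)

lemma nabla_simps [simp]: "nabla x 0 = 0" "nabla x (- u) = - nabla x u" "nabla x (u - v) = nabla x u - nabla x v"
  using nabla_additive by (auto simp: additive.zero additive.minus additive.diff)

lemma br_add: "br (x + y) z = br x z + br y z" "br x (y + z) = br x y + br x z"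
  using linear_add[OF br_linear_left] linear_add[OF br_linear_right] by auto

lemma der_add: "der (f + g) = der f + der g"
  by (rule linear_add[OF der_linear])

lemma ip_add: "ip x (y + z) = ip x y + ip x z"
  using module_hom.add[OF ip_linear] by auto

lemma ip_smult: "ip x (smult f y) = f * ip x y"
  using module_hom.scale[OF ip_linear] by auto

lemma ip_smult_left: "ip (smult f y) x = f * ip y x"
  by (simp only: ip_sym[of _ x] ip_smult)

text \<open>Exchanging the arguments by \<open>br_sym\<close> reduces this to the rule for the
  second argument. The term with \<open>der f\<close> comes from the derivation rule applied to
  \<open>der (f * ip x y)\<close>.\<close>

lemma br_smult_left: "br (smult f x) y = smult f (br x y) + smult (ip x y) (der f) - smult (ip y (der f)) x"
proof -
  have "br (smult f x) y + (smult f (br y x) + smult (ip y (der f)) x) = der (f * ip x y)"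
    using br_sym[of "smult f x" y] by (simp only: ip_smult_left br_smult)
  also have "\<dots> = smult f (br x y + br y x) + smult (ip x y) (der f)"
    by (simp only: der_mult br_sym)
  finally have eq: "br (smult f x) y + (smult f (br y x) + smult (ip y (der f)) x) =
      smult f (br x y) + smult f (br y x) + smult (ip x y) (der f)"
    by (simp only: E.scale_right_distrib)
  have group: "a = c + e - d" if "a + (b + d) = c + b + e" for a b c d e :: 'e
    using that by (simp only: eq_diff_eq ac_simps) (metis add.left_commute add_left_cancel)
  show ?thesis
    using eq by (rule group)
qed

lemma br_der_right: "br x (der f) = der (ip x (der f))"
  using br_sym[of x "der f"] by (simp add: br_der)

section \<open>Multiplication by functions and alternating sums\<close>

definition fscale :: "'r \<Rightarrow> ('e list \<Rightarrow> 'e list \<Rightarrow> 'v) \<Rightarrow> 'e list \<Rightarrow> 'e list \<Rightarrow> 'v" where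
  "fscale f w = (\<lambda>es as. vmult f (w es as))"

lemma fscale_linear:
  "fscale f (w + w') = fscale f w + fscale f w'" "fscale f (w - w') = fscale f w - fscale f w'"
  "fscale f (- w) = - fscale f w" "fscale f 0 = 0" "fscale (f + g) w = fscale f w + fscale g w"
  "fscale f (fscale g w) = fscale (f * g) w" "fscale 0 w = 0"
  by (simp_all add: fscale_def fun_eq_iff V.scale_right_distrib V.scale_right_diff_distrib V.scale_left_distrib)

lemma fscale_contract: "contract x (fscale f w) = fscale f (contract x w)" and fscale_contract_H: "contract_H x (fscale f w) = fscale f (contract_H x w)"
  by (simp_all add: fscale_def contract_def contract_H_def)

text \<open>One argument from \<open>E\<close> is removed with its sign and handed to
  \<open>F\<close>. The correction term of the \<open>R\<close>-linearity rule and the operator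
  \<open>d_prime\<close> are both of this form.\<close>

definition alt :: "('e \<Rightarrow> 'e list \<Rightarrow> 'e list \<Rightarrow> 'v) \<Rightarrow> 'e list \<Rightarrow> 'e list \<Rightarrow> 'v" where
  "alt F es as = (\<Sum>b<length es. vmult ((-1) ^ b) (F (es ! b) (nths es (- {b})) as))"

lemma alt_Nil [simp]: "alt F [] as = 0"
  by (simp add: alt_def)

text \<open>The new first argument is either the removed one, or it stays and shifts the removed
  position by one, which flips the sign. Inductions over the arguments from \<open>E\<close> treat
  alternating sums through this recursion.\<close>

lemma contract_alt: "contract x (alt F) = F x - alt (\<lambda>y. contract x (F y))"
  by (simp add: fun_eq_iff contract_def alt_def sum.lessThan_Suc_shift nths_Cons_omit sum_negf del: sum.lessThan_Suc)

lemma contract_H_alt: "contract_H x (alt F) = alt (\<lambda>y. contract_H x (F y))"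
  by (simp add: fun_eq_iff contract_H_def alt_def)

lemma alt_linear:
  "alt (\<lambda>x. F x + G x) = alt F + alt G" "alt (\<lambda>x. F x - G x) = alt F - alt G"
  "alt (\<lambda>x. - F x) = - alt F" "alt (\<lambda>x. 0) = 0" "alt (\<lambda>x. fscale f (F x)) = fscale f (alt F)"
  by (simp_all add: fun_eq_iff alt_def fscale_def V.scale_right_distrib V.scale_right_diff_distrib sum.distrib
      sum_subtractf sum_negf V.scale_sum_right mult.commute)

section \<open>Vanishing outside \<open>H\<close> and symmetry in the arguments from
  \<open>H\<close>\<close>

definition off :: "('e list \<Rightarrow> 'e list \<Rightarrow> 'v) \<Rightarrow> bool" where
  "off w \<longleftrightarrow> (\<forall>es as. \<not> set as \<subseteq> H \<longrightarrow> w es as = 0)"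

definition hsym :: "('e list \<Rightarrow> 'e list \<Rightarrow> 'v) \<Rightarrow> bool" where
  "hsym w \<longleftrightarrow> (\<forall>es as bs. mset as = mset bs \<longrightarrow> w es as = w es bs)"

lemma off_simps:
  "off w \<Longrightarrow> off w' \<Longrightarrow> off (w + w')" "off w \<Longrightarrow> off w' \<Longrightarrow> off (w - w')"
  "off w \<Longrightarrow> off (- w)" "off 0" "off w \<Longrightarrow> off (fscale f w)" "off w \<Longrightarrow> off (contract x w)"
  "off w \<Longrightarrow> off (contract_H x w)" "(\<And>x. off (F x)) \<Longrightarrow> off (alt F)"
  by (auto simp: off_def fscale_def contract_def contract_H_def alt_def)

lemma off_eqI: "off w \<Longrightarrow> off w' \<Longrightarrow> (\<And>es as. set as \<subseteq> H \<Longrightarrow> w es as = w' es as) \<Longrightarrow> w = w'"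
  unfolding off_def fun_eq_iff by metis

lemma hsymI: "(\<And>es as bs. mset as = mset bs \<Longrightarrow> w es as = w es bs) \<Longrightarrow> hsym w"
  unfolding hsym_def by blast

lemma hsymD: "hsym w \<Longrightarrow> mset as = mset bs \<Longrightarrow> w es as = w es bs"
  unfolding hsym_def by blast

lemma hsym_simps:
  "hsym w \<Longrightarrow> hsym w' \<Longrightarrow> hsym (w + w')" "hsym w \<Longrightarrow> hsym w' \<Longrightarrow> hsym (w - w')"
  "hsym w \<Longrightarrow> hsym (- w)" "hsym 0" "hsym w \<Longrightarrow> hsym (fscale f w)" "hsym w \<Longrightarrow> hsym (contract x w)"
  unfolding hsym_def fscale_def contract_def plus_fun_apply minus_apply uminus_apply zero_fun_apply by metis+

lemma hsym_contract_H_closed: "hsym w \<Longrightarrow> hsym (contract_H b w)"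
  unfolding contract_H_def by (intro hsymI) (erule hsymD, simp)

lemma hsym_alt: "(\<And>x. hsym (F x)) \<Longrightarrow> hsym (alt F)"
  unfolding alt_def by (intro hsymI sum.cong refl arg_cong[where f="vmult _"]) (rule hsymD)

lemma hsym_contract_H: "hsym w \<Longrightarrow> contract_H a (contract_H b w) = contract_H b (contract_H a w)"
  unfolding contract_H_def by (intro ext) (erule hsymD, simp)

text \<open>
  The defining identities are imposed on the first argument only. They pass to every position because
  they are required to persist when the leading arguments are fixed, which makes the class closed
  under contraction.
\<close>

definition first_cond :: "('e list \<Rightarrow> 'e list \<Rightarrow> 'v) \<Rightarrow> bool" where
  "first_cond w \<longleftrightarrow> off w \<and> hsym w \<and>
    (\<forall>x y. contract (x + y) w = contract x w + contract y w) \<and>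
    (\<forall>a\<in>H. \<forall>b\<in>H. contract_H (a + b) w = contract_H a w + contract_H b w) \<and>
    (\<forall>x y. contract x (contract y w) + contract y (contract x w) = - contract_H (der (ip x y)) w) \<and>
    (\<forall>f x. contract (smult f x) w = fscale f (contract x w) - alt (\<lambda>y. fscale (ip x y) (contract_H (der f) w))) \<and>
    (\<forall>f. \<forall>a\<in>H. contract_H (smult f a) w = fscale f (contract_H a w))"

definition pre :: "'e list \<Rightarrow> ('e list \<Rightarrow> 'e list \<Rightarrow> 'v) \<Rightarrow> 'e list \<Rightarrow> 'e list \<Rightarrow> 'v" where
  "pre p w = (\<lambda>es as. w (p @ es) as)"

definition cochain_cond :: "('e list \<Rightarrow> 'e list \<Rightarrow> 'v) \<Rightarrow> bool" where
  "cochain_cond w \<longleftrightarrow> (\<forall>p. first_cond (pre p w))"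

lemma pre_Nil [simp]: "pre [] w = w" and pre_Cons: "pre (x # p) w = pre p (contract x w)"
  by (simp_all add: pre_def contract_def)

lemma pre_linear: "pre p (v + w) = pre p v + pre p w" "pre p (- w) = - pre p w" "pre p (contract_H b w) = contract_H b (pre p w)"
  "pre p (fscale f w) = fscale f (pre p w)"
  by (simp_all add: pre_def contract_H_def fscale_def fun_eq_iff)

text \<open>\<open>cochain_cond\<close> is the largest class inside \<open>first_cond\<close> that
  is closed under contraction, so membership follows from any invariant \<open>X\<close> with these
  two properties.\<close>

lemma cochain_cond_coinduct:
  assumes "X w" and "\<And>w. X w \<Longrightarrow> first_cond w" and "\<And>w x. X w \<Longrightarrow> X (contract x w)"
  shows "cochain_cond w"
proof -
  have "first_cond (pre p w)" for p
    using assms(1) by (induction p arbitrary: w) (simp_all add: pre_Cons assms(2,3))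
  then show ?thesis by (simp add: cochain_cond_def)
qed

lemma cochain_cond_first_cond: "cochain_cond w \<Longrightarrow> first_cond w"
  unfolding cochain_cond_def by (metis pre_Nil)

lemma cochain_cond_contract: "cochain_cond w \<Longrightarrow> cochain_cond (contract x w)"
  unfolding cochain_cond_def by (metis pre_Cons)

lemma cochain_condD:
  assumes "cochain_cond w"
  shows "off w" "hsym w" "contract (x + y) w = contract x w + contract y w"
    "a \<in> H \<Longrightarrow> b \<in> H \<Longrightarrow> contract_H (a + b) w = contract_H a w + contract_H b w"
    "contract (smult f x) w = fscale f (contract x w) - alt (\<lambda>y. fscale (ip x y) (contract_H (der f) w))"
    "a \<in> H \<Longrightarrow> contract_H (smult f a) w = fscale f (contract_H a w)"
  using cochain_cond_first_cond[OF assms] by (auto simp: first_cond_def)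

section \<open>Closure properties of the cochain conditions\<close>

lemma first_cond_add:
  assumes "first_cond v" "first_cond w" shows "first_cond (v + w)"
proof -
  \<comment> \<open>Regrouped so that the anticommutators of \<open>v\<close> and \<open>w\<close>
    appear literally and their hypotheses can rewrite them.\<close>
  have c: "contract x (contract y (v + w)) + contract y (contract x (v + w)) =
      (contract x (contract y v) + contract y (contract x v)) + (contract x (contract y w) + contract y (contract x w))" for x y
    by (simp only: contract_linear ac_simps)
  show ?thesis unfolding first_cond_def c
    using assms unfolding first_cond_def
    by (simp add: off_simps hsym_simps contract_linear contract_H_linear fscale_linear alt_linear)
qed

lemma first_cond_uminus:
  assumes "first_cond w" shows "first_cond (- w)"
proof -
  have c: "contract x (contract y (- w)) + contract y (contract x (- w)) = - (contract x (contract y w) + contract y (contract x w))" for x y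
    by (simp only: contract_linear minus_add_distrib)
  show ?thesis unfolding first_cond_def c
    using assms unfolding first_cond_def
    by (simp add: off_simps hsym_simps contract_linear contract_H_linear fscale_linear alt_linear)
qed

lemma cochain_cond_0: "cochain_cond 0"
  by (rule cochain_cond_coinduct[where X="\<lambda>w. w = 0"])
    (simp_all add: first_cond_def off_simps hsym_simps contract_linear contract_H_linear fscale_linear alt_linear)

lemma contract_anticomm: "cochain_cond w \<Longrightarrow> contract x (contract y w) + contract y (contract x w) = - contract_H (der (ip x y)) w"
  using cochain_cond_first_cond by (auto simp: first_cond_def)

lemma first_cond_contract_H:
  assumes w: "first_cond w" and b: "b \<in> H" shows "first_cond (contract_H b w)"
proof -
  have s: "contract_H a (contract_H b w) = contract_H b (contract_H a w)" for a
    using w hsym_contract_H by (auto simp: first_cond_def)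
  have c: "contract x (contract y (contract_H b w)) + contract y (contract x (contract_H b w)) = contract_H b (contract x (contract y w) + contract y (contract x w))" for x y
    by (simp add: contract_H_linear contract_H_contract)
  show ?thesis unfolding first_cond_def c unfolding s
    using w unfolding first_cond_def
    by (simp add: off_simps hsym_simps hsym_contract_H_closed hsym_alt contract_H_linear fscale_linear alt_linear fscale_contract_H contract_H_alt s flip: contract_H_contract)
qed

lemma cochain_cond_add: "cochain_cond v \<Longrightarrow> cochain_cond w \<Longrightarrow> cochain_cond (v + w)"
  unfolding cochain_cond_def pre_linear using first_cond_add by blast

lemma cochain_cond_uminus: "cochain_cond w \<Longrightarrow> cochain_cond (- w)"
  unfolding cochain_cond_def pre_linear using first_cond_uminus by blast

lemma cochain_cond_diff: "cochain_cond v \<Longrightarrow> cochain_cond w \<Longrightarrow> cochain_cond (v - w)"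
  using cochain_cond_add[of v "- w"] cochain_cond_uminus by simp

lemma cochain_cond_contract_H: "cochain_cond w \<Longrightarrow> b \<in> H \<Longrightarrow> cochain_cond (contract_H b w)"
  unfolding cochain_cond_def pre_linear using first_cond_contract_H by blast

subsection \<open>The Lie derivative\<close>

text \<open>The bracketed argument from \<open>H\<close> is moved to the front, which for symmetric
  \<open>w\<close> is the same as acting in place. The case distinction makes \<open>Lie x w\<close>
  vanish outside \<open>H\<close> for every \<open>w\<close>.\<close>

definition Lie :: "'e \<Rightarrow> ('e list \<Rightarrow> 'e list \<Rightarrow> 'v) \<Rightarrow> 'e list \<Rightarrow> 'e list \<Rightarrow> 'v" where
  "Lie x w es as = (if set as \<subseteq> H then nabla x (w es as) - (\<Sum>b<length es. w (es[b := br x (es ! b)]) as)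
     - psum (\<lambda>a r. w es (br x a # r)) as else 0)"

lemma off_Lie [simp]: "off (Lie x w)"
  by (simp add: off_def Lie_def)

lemma hsym_Lie:
  assumes w: "hsym w" shows "hsym (Lie x w)"
proof (rule hsymI)
  fix es as bs :: "'e list" assume eq: "mset as = mset bs"
  have "psum (\<lambda>a r. w es (br x a # r)) as = psum (\<lambda>a r. w es (br x a # r)) bs"
    by (rule psum_mset[OF _ eq], rule hsymD[OF w]) simp
  then show "Lie x w es as = Lie x w es bs"
    unfolding Lie_def mset_eq_setD[OF eq] hsymD[OF w eq] by simp
qed

lemma Lie_Nil: "Lie x w [] [] = nabla x (w [] [])"
  by (simp add: Lie_def)

text \<open>The commutator consists of the single term in which \<open>x\<close> acts on the
  inserted argument \<open>y\<close>.\<close>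

lemma contract_Lie:
  assumes "off w" shows "contract y (Lie x w) = Lie x (contract y w) - contract (br x y) w"
proof (rule off_eqI)
  fix es as :: "'e list" assume "set as \<subseteq> H"
  then show "contract y (Lie x w) es as = (Lie x (contract y w) - contract (br x y) w) es as"
    by (simp add: contract_def Lie_def sum.lessThan_Suc_shift del: sum.lessThan_Suc)
qed (use assms in \<open>simp_all add: off_simps\<close>)

lemma contract_H_Lie:
  assumes w: "off w" "hsym w" and b: "b \<in> H" shows "contract_H b (Lie x w) = Lie x (contract_H b w) - contract_H (br x b) w"
proof (rule off_eqI)
  fix es as :: "'e list" assume as: "set as \<subseteq> H"
  have "w es (br x a # b # r) = w es (b # br x a # r)" for a r
    by (rule hsymD[OF w(2)]) simp
  then show "contract_H b (Lie x w) es as = (Lie x (contract_H b w) - contract_H (br x b) w) es as"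
    using as b by (simp add: contract_H_def Lie_def psum_Cons)
qed (use w in \<open>simp_all add: off_simps\<close>)

lemma Lie_linear:
  "Lie x (v + w) = Lie x v + Lie x w" "Lie x (v - w) = Lie x v - Lie x w" "Lie x (- w) = - Lie x w" "Lie x 0 = 0"
  by (simp_all add: fun_eq_iff Lie_def sum.distrib sum_subtractf sum_negf psum_add psum_diff psum_uminus)

text \<open>Only \<open>nabla\<close> fails to commute with multiplication by \<open>f\<close>, and
  its derivation rule supplies the extra term.\<close>

lemma Lie_fscale:
  assumes "off w" shows "Lie x (fscale f w) = fscale (ip x (der f)) w + fscale f (Lie x w)"
proof (rule off_eqI)
  have p: "psum (\<lambda>a r. vmult f (F a r)) as = vmult f (psum F as)" for F and as :: "'e list"
    by (simp add: psum_def V.scale_sum_right)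
  fix es as :: "'e list" assume "set as \<subseteq> H"
  then show "Lie x (fscale f w) es as = (fscale (ip x (der f)) w + fscale f (Lie x w)) es as"
    by (simp add: fscale_def Lie_def nabla_vmult V.scale_sum_right V.scale_right_diff_distrib p)
qed (use assms in \<open>simp_all add: off_simps\<close>)

section \<open>Commutation relations for the Lie derivative\<close>

text \<open>Two operators are compared by stripping first the arguments from \<open>E\<close> and
  then, with none of those left, the arguments from \<open>H\<close>. The induction hypothesis
  ranges over the whole class \<open>P\<close>, so that it applies to contractions of
  \<open>w\<close>. In the second stage every alternating sum is zero.\<close>

lemma operator_eqI:
  assumes "P w"
    and contract: "\<And>w x es as. P w \<Longrightarrow> (\<And>w. P w \<Longrightarrow> A w es as = B w es as) \<Longrightarrow> set as \<subseteq> H \<Longrightarrow> contract x (A w) es as = contract x (B w) es as"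
    and contract_H: "\<And>w b as. P w \<Longrightarrow> (\<And>w. P w \<Longrightarrow> A w [] as = B w [] as) \<Longrightarrow> set as \<subseteq> H \<Longrightarrow> b \<in> H \<Longrightarrow> contract_H b (A w) [] as = contract_H b (B w) [] as"
    and Nil: "\<And>w. P w \<Longrightarrow> A w [] [] = B w [] []"
    and off: "off (A w)" "off (B w)"
  shows "A w = B w"
proof -
  have *: "A w [] as = B w [] as" if "P w" "set as \<subseteq> H" for w as
    using that
  proof (induction as arbitrary: w)
    case (Cons b as)
    then have "contract_H b (A w) [] as = contract_H b (B w) [] as" by (intro contract_H) auto
    then show ?case by (simp add: contract_H_def)
  qed (simp add: Nil)
  have "A w es as = B w es as" if "P w" "set as \<subseteq> H" for w es as
    using that
  proof (induction es arbitrary: w)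
    case (Cons x es)
    then have "contract x (A w) es as = contract x (B w) es as" by (intro contract) auto
    then show ?case by (simp add: contract_def)
  qed (simp add: *)
  with assms(1) off show ?thesis by (intro off_eqI) auto
qed

text \<open>Through Cartan's formula, this yields additivity of \<open>D w\<close> in its first
  argument.\<close>

lemma Lie_add:
  assumes "cochain_cond w" shows "Lie (x + y) w = Lie x w + Lie y w"
proof (rule operator_eqI[where P=cochain_cond and w=w and A="Lie (x + y)" and B="\<lambda>w. Lie x w + Lie y w"])
  fix w z es as assume w: "cochain_cond w" and IH: "\<And>w. cochain_cond w \<Longrightarrow> Lie (x + y) w es as = (Lie x w + Lie y w) es as"
  have "contract (br (x + y) z) w = contract (br x z) w + contract (br y z) w"
    by (simp add: br_add cochain_condD[OF w])
  then show "contract z (Lie (x + y) w) es as = contract z (Lie x w + Lie y w) es as"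
    using IH[OF cochain_cond_contract[OF w]] by (simp add: contract_Lie contract_linear cochain_condD[OF w])
next
  fix w b as assume w: "cochain_cond w" and b: "b \<in> H"
    and IH: "\<And>w. cochain_cond w \<Longrightarrow> Lie (x + y) w [] as = (Lie x w + Lie y w) [] as"
  have "contract_H (br (x + y) b) w = contract_H (br x b) w + contract_H (br y b) w"
    by (simp add: br_add cochain_condD[OF w] H_closed b)
  then show "contract_H b (Lie (x + y) w) [] as = contract_H b (Lie x w + Lie y w) [] as"
    using IH[OF cochain_cond_contract_H[OF w b]] by (simp add: contract_H_Lie contract_H_linear cochain_condD[OF w] b)
qed (simp_all add: assms Lie_Nil off_simps)

text \<open>On each argument the identity is the Leibniz identity \<open>br_leibniz\<close>; on the
  value, where no arguments remain, it is the flatness \<open>nabla_br\<close>.\<close>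

lemma Lie_br:
  assumes "cochain_cond w" shows "Lie (br x y) w = Lie x (Lie y w) - Lie y (Lie x w)"
proof (rule operator_eqI[where P=cochain_cond and w=w and A="Lie (br x y)" and B="\<lambda>w. Lie x (Lie y w) - Lie y (Lie x w)"])
  fix w z es as assume w: "cochain_cond w"
    and IH: "\<And>w. cochain_cond w \<Longrightarrow> Lie (br x y) w es as = (Lie x (Lie y w) - Lie y (Lie x w)) es as"
  have "contract (br x (br y z)) w = contract (br (br x y) z) w + contract (br y (br x z)) w"
    by (simp add: br_leibniz[of x y z] cochain_condD[OF w])
  then show "contract z (Lie (br x y) w) es as = contract z (Lie x (Lie y w) - Lie y (Lie x w)) es as"
    using IH[OF cochain_cond_contract[OF w]] by (simp add: contract_Lie contract_linear cochain_condD(1)[OF w] Lie_linear)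
next
  fix w b as assume w: "cochain_cond w" and b: "b \<in> H"
    and IH: "\<And>w. cochain_cond w \<Longrightarrow> Lie (br x y) w [] as = (Lie x (Lie y w) - Lie y (Lie x w)) [] as"
  have "contract_H (br x (br y b)) w = contract_H (br (br x y) b) w + contract_H (br y (br x b)) w"
    by (simp add: br_leibniz[of x y b] cochain_condD[OF w] H_closed b)
  then show "contract_H b (Lie (br x y) w) [] as = contract_H b (Lie x (Lie y w) - Lie y (Lie x w)) [] as"
    using IH[OF cochain_cond_contract_H[OF w b]] by (simp add: contract_H_Lie contract_H_linear cochain_condD(1,2)[OF w] b H_closed hsym_Lie Lie_linear)
qed (simp_all add: assms Lie_Nil off_simps nabla_br)

text \<open>The Lie derivative of the sum also acts on the argument that \<open>alt\<close> removes
  and hands to \<open>F\<close>; the term \<open>F (br x y)\<close> accounts for this.\<close>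

lemma Lie_alt:
  assumes "\<And>y. off (F y)" shows "Lie x (alt F) = alt (\<lambda>y. Lie x (F y) - F (br x y))"
proof -
  define P :: "('e \<Rightarrow> 'e list \<Rightarrow> 'e list \<Rightarrow> 'v) \<Rightarrow> bool" where "P F \<longleftrightarrow> (\<forall>y. off (F y))" for F
  have "Lie x (alt F) es as = alt (\<lambda>y. Lie x (F y) - F (br x y)) es as" if "set as \<subseteq> H" "P F" for es as
    using that(2)
  proof (induction es arbitrary: F)
    case Nil
    show ?case by (simp add: Lie_def)
  next
    case (Cons z es)
    have "P (\<lambda>y. contract z (F y))" using Cons.prems by (simp add: P_def off_simps)
    define N where "N = alt (\<lambda>y. Lie x (contract z (F y)) - contract z (F (br x y)))"
    have IH: "Lie x (alt (\<lambda>y. contract z (F y))) es as = N es as"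
      unfolding N_def using \<open>P (\<lambda>y. contract z (F y))\<close> by (rule Cons.IH)
    have "contract z (Lie x (alt F)) = Lie x (F z) - Lie x (alt (\<lambda>y. contract z (F y))) - (F (br x z) - alt (\<lambda>y. contract (br x z) (F y)))"
      using Cons.prems by (simp add: P_def contract_Lie off_simps contract_alt Lie_linear)
    moreover have "contract z (alt (\<lambda>y. Lie x (F y) - F (br x y))) = Lie x (F z) - F (br x z) - (N - alt (\<lambda>y. contract (br x z) (F y)))"
      unfolding N_def using Cons.prems
      by (simp add: P_def contract_alt contract_linear contract_Lie off_simps flip: alt_linear(2)) (simp add: algebra_simps)
    ultimately have "contract z (Lie x (alt F)) es as = contract z (alt (\<lambda>y. Lie x (F y) - F (br x y))) es as"
      by (simp add: IH)
    then show ?case by (simp only: contract_def)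
  qed
  with assms show ?thesis
    by (intro off_eqI off_simps) (auto simp: P_def)
qed

text \<open>Each condition on \<open>w\<close> is invariant under the action of \<open>x\<close>:
  anticommutation and \<open>R\<close>-linearity both rest on the invariance \<open>br_ip\<close> of
  the pairing, together with \<open>br_der_right\<close> and \<open>br_smult\<close>.\<close>

lemma first_cond_Lie:
  assumes w: "cochain_cond w" shows "first_cond (Lie x w)"
  unfolding first_cond_def
proof (intro conjI allI ballI)
  show "off (Lie x w)" "hsym (Lie x w)" using cochain_condD[OF w] by (simp_all add: hsym_Lie)
  fix y z f
  show "contract (y + z) (Lie x w) = contract y (Lie x w) + contract z (Lie x w)"
    by (simp add: contract_Lie cochain_condD[OF w] Lie_linear br_add)
  have "contract y (contract z (Lie x w)) + contract z (contract y (Lie x w)) =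
      Lie x (contract y (contract z w) + contract z (contract y w)) -
      (contract (br x y) (contract z w) + contract z (contract (br x y) w)) - (contract y (contract (br x z) w) + contract (br x z) (contract y w))"
    by (simp add: contract_Lie cochain_condD(1)[OF w] off_simps Lie_linear contract_linear)
  also have "\<dots> = - (Lie x (contract_H (der (ip y z)) w) - contract_H (der (ip (br x y) z) + der (ip y (br x z))) w)"
    by (simp add: contract_anticomm[OF w] Lie_linear cochain_condD(4)[OF w] H_closed)
  \<comment> \<open>By \<open>br_ip\<close> the two pairings add up to
    \<open>ip x (der (ip y z))\<close>, and \<open>br_der_right\<close> identifies its image under
    \<open>der\<close> with \<open>br x (der (ip y z))\<close>, the correction in
    \<open>contract_H_Lie\<close>.\<close>
  also have "\<dots> = - contract_H (der (ip y z)) (Lie x w)"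
    by (simp add: contract_H_Lie cochain_condD[OF w] H_closed br_der_right br_ip der_add)
  finally show "contract y (contract z (Lie x w)) + contract z (contract y (Lie x w)) = - contract_H (der (ip y z)) (Lie x w)" .
  have o: "off w" "hsym w" using cochain_condD[OF w] by auto
  have "contract (smult f y) (Lie x w) = Lie x (contract (smult f y) w) - contract (smult f (br x y) + smult (ip x (der f)) y) w"
    by (simp add: contract_Lie o br_smult)
  also have "contract (smult f (br x y) + smult (ip x (der f)) y) w = fscale f (contract (br x y) w)
      - alt (\<lambda>z. fscale (ip (br x y) z) (contract_H (der f) w))
      + fscale (ip x (der f)) (contract y w) - alt (\<lambda>z. fscale (ip y z) (contract_H (der (ip x (der f))) w))"
    by (simp add: cochain_condD(3,5)[OF w])
  also have "Lie x (contract (smult f y) w) = fscale (ip x (der f)) (contract y w) + fscale f (Lie x (contract y w))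
      - alt (\<lambda>z. Lie x (fscale (ip y z) (contract_H (der f) w)) - fscale (ip y (br x z)) (contract_H (der f) w))"
    by (simp add: cochain_condD(5)[OF w] Lie_linear Lie_fscale Lie_alt o off_simps)
  \<comment> \<open>\<open>Lie_fscale\<close> brings in \<open>ip x (der (ip y z))\<close>. Its part
    \<open>ip y (br x z)\<close> cancels here; the part \<open>ip (br x y) z\<close> cancels next
    against the correction for \<open>smult f (br x y)\<close>.\<close>
  also have "alt (\<lambda>z. Lie x (fscale (ip y z) (contract_H (der f) w)) - fscale (ip y (br x z)) (contract_H (der f) w)) =
      alt (\<lambda>z. fscale (ip (br x y) z) (contract_H (der f) w)) + alt (\<lambda>z. fscale (ip y z) (Lie x (contract_H (der f) w)))"
    by (simp add: Lie_fscale o off_simps br_ip fscale_linear flip: alt_linear(1))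
  also have "fscale (ip x (der f)) (contract y w) + fscale f (Lie x (contract y w)) -
      (alt (\<lambda>z. fscale (ip (br x y) z) (contract_H (der f) w)) + alt (\<lambda>z. fscale (ip y z) (Lie x (contract_H (der f) w)))) -
      (fscale f (contract (br x y) w) - alt (\<lambda>z. fscale (ip (br x y) z) (contract_H (der f) w))
      + fscale (ip x (der f)) (contract y w) - alt (\<lambda>z. fscale (ip y z) (contract_H (der (ip x (der f))) w))) =
      fscale f (contract y (Lie x w)) - alt (\<lambda>z. fscale (ip y z) (contract_H (der f) (Lie x w)))"
    by (simp add: contract_Lie contract_H_Lie o H_closed br_der_right fscale_linear alt_linear)
  finally show "contract (smult f y) (Lie x w) = fscale f (contract y (Lie x w)) - alt (\<lambda>z. fscale (ip y z) (contract_H (der f) (Lie x w)))" .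
next
  fix a b f assume a: "a \<in> H" 
  show "contract_H (smult f a) (Lie x w) = fscale f (contract_H a (Lie x w))"
    by (simp add: contract_H_Lie cochain_condD[OF w] Lie_fscale off_simps fscale_linear br_smult a H_closed)
  assume b: "b \<in> H"
  show "contract_H (a + b) (Lie x w) = contract_H a (Lie x w) + contract_H b (Lie x w)"
    by (simp add: contract_H_Lie cochain_condD[OF w] Lie_linear br_add a b H_closed)
qed

lemma cochain_cond_Lie: "cochain_cond w \<Longrightarrow> cochain_cond (Lie x w)"
\<comment> \<open>Contracting \<open>Lie x v\<close> produces the extra cochain
  \<open>- contract (br x y) v\<close>, so the invariant needs a free summand
  \<open>w\<close>.\<close>
proof (rule cochain_cond_coinduct[where X="\<lambda>u. \<exists>v w. u = Lie x v + w \<and> cochain_cond v \<and> cochain_cond w"])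
  fix u y assume "\<exists>v w. u = Lie x v + w \<and> cochain_cond v \<and> cochain_cond w"
  then obtain v w where u: "u = Lie x v + w" "cochain_cond v" "cochain_cond w" by blast
  then show "first_cond u" by (simp add: first_cond_add first_cond_Lie cochain_cond_first_cond)
  have "contract y u = Lie x (contract y v) + (contract y w - contract (br x y) v)"
    using u by (simp add: contract_linear contract_Lie cochain_condD)
  then show "\<exists>v w. contract y u = Lie x v + w \<and> cochain_cond v \<and> cochain_cond w"
    using u cochain_cond_contract cochain_cond_diff by blast
qed (intro exI[of _ w] exI[of _ 0], simp add: cochain_cond_0)

subsection \<open>The differential\<close>

text \<open>The three summands are the Leibniz coboundary, \<delta> and d'. \<open>d_Leibniz\<close>
  does not change the index of its cochain, so it is applied to a constant family at the dummy index
  \<open>0\<close>.\<close>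

definition D :: "('e list \<Rightarrow> 'e list \<Rightarrow> 'v) \<Rightarrow> 'e list \<Rightarrow> 'e list \<Rightarrow> 'v" where
  "D w es as = (if set as \<subseteq> H then d_Leibniz br vmult nabla (\<lambda>k. w) 0 es as + psum (\<lambda>a. w (a # es)) as
     + alt (\<lambda>x es as. psum (\<lambda>a r. w es (br a x # r)) as) es as else 0)"

lemma off_D [simp]: "off (D w)"
  by (simp add: off_def D_def)

lemma hsym_D:
  assumes w: "hsym w" shows "hsym (D w)"
proof (rule hsymI)
  fix es as bs :: "'e list" assume eq: "mset as = mset bs"
  have P: "psum (\<lambda>a. w (a # es)) as = psum (\<lambda>a. w (a # es)) bs" for es
    by (rule psum_mset[OF hsymD[OF w] eq])
  have "hsym (alt (\<lambda>x es as. psum (\<lambda>a r. w es (br a x # r)) as))"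
    by (intro hsym_alt hsymI psum_mset hsymD[OF w]) auto
  note A = hsymD[OF this eq]
  show "D w es as = D w es bs"
    unfolding D_def d_Leibniz_def mset_eq_setD[OF eq] hsymD[OF w eq] P A ..
qed

lemma D_Nil: "set as \<subseteq> H \<Longrightarrow> D w [] as = psum (\<lambda>a. w [a]) as"
  by (simp add: D_def d_Leibniz_def)

text \<open>Terms in which \<open>x\<close> acts form the part of \<open>Lie x\<close> on the value
  and on the arguments from \<open>E\<close>. In all others \<open>x\<close> is a fixed first
  argument, and the shift of positions flips the sign.\<close>

lemma d_Leibniz_Cons:
  "d_Leibniz br vmult nabla (\<lambda>k. w) 0 (x # es) as = nabla x (w es as) - (\<Sum>b<length es. w (es[b := br x (es ! b)]) as)
     - d_Leibniz br vmult nabla (\<lambda>k. contract x w) 0 es as"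
  by (simp add: d_Leibniz_def contract_def sum.lessThan_Suc_shift nths_Cons_omit sum_negf sum_subtractf sum.distrib del: sum.lessThan_Suc)

lemma D_linear:
  "D (v + w) = D v + D w" "D (v - w) = D v - D w" "D (- w) = - D w" "D 0 = 0"
proof -
  define T where "T w = (\<lambda>x es as. psum (\<lambda>a r. w es (br a x # r)) as)" for w :: "'e list \<Rightarrow> 'e list \<Rightarrow> 'v"
  define L where "L w = (\<lambda>es as. d_Leibniz br vmult nabla (\<lambda>k. w) 0 es as + psum (\<lambda>a r. w (a # es) r) as)" for w :: "'e list \<Rightarrow> 'e list \<Rightarrow> 'v"
  have D: "D w es as = (if set as \<subseteq> H then L w es as + alt (T w) es as else 0)" for w es as
    by (simp add: D_def L_def T_def)
  \<comment> \<open>Only additivity is checked on the formulas; zero, negatives and differences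
    follow formally.\<close>
  have add: "D (v + w) = D v + D w" for v w
  proof -
    have "T (v + w) = (\<lambda>x. T v x + T w x)"
      by (simp add: T_def fun_eq_iff psum_add)
    then have "alt (T (v + w)) = alt (T v) + alt (T w)"
      by (simp only: alt_linear(1))
    moreover have "L (v + w) = L v + L w"
      by (simp add: L_def fun_eq_iff psum_add d_Leibniz_def sum.distrib V.scale_right_distrib del: power_Suc)
    ultimately show ?thesis
      by (intro ext) (simp add: D)
  qed
  show "D (v + w) = D v + D w" by (rule add)
  show zero: "D 0 = 0"
    by (rule add_left_imp_eq[of "D 0"]) (simp only: add[THEN HOL.sym] add_0_right)
  have "D w + D (- w) = 0"
    by (simp only: add[THEN HOL.sym] add.right_inverse zero)
  then show "D (- w) = - D w"
    by (rule minus_unique[THEN HOL.sym])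
  have "D (v - w) + D w = D v"
    by (simp only: add[THEN HOL.sym] diff_add_cancel)
  then show "D (v - w) = D v - D w"
    by (simp only: eq_diff_eq)
qed

text \<open>Only \<open>nabla\<close> differentiates \<open>f\<close>; the extra terms form the
  product of the differential of \<open>f\<close> with \<open>w\<close>.\<close>

lemma D_fscale:
  assumes "off w" shows "D (fscale f w) = fscale f (D w) + alt (\<lambda>x. fscale (ip x (der f)) w)"
proof (rule off_eqI)
  have p: "psum (\<lambda>a r. vmult f (F a r)) as = vmult f (psum F as)" for F and as :: "'e list"
    by (simp add: psum_def V.scale_sum_right)
  fix es as :: "'e list" assume "set as \<subseteq> H"
  then show "D (fscale f w) es as = (fscale f (D w) + alt (\<lambda>x. fscale (ip x (der f)) w)) es as"
    by (simp add: D_def d_Leibniz_def alt_def fscale_def nabla_vmult V.scale_sum_right V.scale_right_distrib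
        sum.distrib p mult.commute)
qed (use assms in \<open>simp_all add: off_simps\<close>)

section \<open>Commutation of contractions and Lie derivatives with the differential\<close>

text \<open>Cartan's formula. The Leibniz coboundary yields the action on the value and on the
  arguments from \<open>E\<close>; \<delta> and d' together yield the action on the arguments from
  \<open>H\<close>.\<close>

lemma contract_D:
  assumes w: "cochain_cond w" shows "contract x (D w) = Lie x w - D (contract x w)"
proof (rule off_eqI)
  fix es as :: "'e list" assume as: "set as \<subseteq> H"
  \<comment> \<open>Exchanging \<open>a\<close> and \<open>x\<close> costs
    \<open>der (ip a x)\<close>, which \<open>br_sym\<close> splits in two: \<open>br a x\<close>
    cancels the d' term in which \<open>x\<close> acts, and \<open>br x a\<close> is the term
    required by \<open>Lie x\<close>.\<close>
  have p: "w (a # x # es) r + w es (br a x # r) = - w es (br x a # r) - w (x # a # es) r"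
     if a: "a \<in> set as" for a r
  proof -
    have "a \<in> H" using a as by auto
    then have "contract_H (der (ip a x)) w = contract_H (br a x) w + contract_H (br x a) w"
      by (simp add: cochain_condD(4)[OF w] H_closed flip: br_sym)
    with contract_anticomm[OF w, of a x] have "contract a (contract x w) + contract x (contract a w) = - (contract_H (br a x) w + contract_H (br x a) w)"
      by simp
    then have "(contract a (contract x w) + contract x (contract a w)) es r = (- (contract_H (br a x) w + contract_H (br x a) w)) es r"
      by simp
    then have eq: "w (a # x # es) r + w (x # a # es) r = - (w es (br a x # r) + w es (br x a # r))"
      by (simp add: contract_def contract_H_def add.commute)
    have "w (a # x # es) r + w es (br a x # r) =
        (w (a # x # es) r + w (x # a # es) r) + w es (br a x # r) - w (x # a # es) r"
      by simp
    then show ?thesis unfolding eq by simp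
  qed
  have "psum (\<lambda>a r. w (a # x # es) r + w es (br a x # r)) as = psum (\<lambda>a r. - w es (br x a # r) - w (x # a # es) r) as"
    by (rule psum_cong) (simp add: p)
  then have "psum (\<lambda>a. w (a # x # es)) as + psum (\<lambda>a r. w es (br a x # r)) as =
     - psum (\<lambda>a r. w es (br x a # r)) as - psum (\<lambda>a. w (x # a # es)) as"
    by (simp add: psum_add psum_diff psum_uminus)
  moreover have "alt (\<lambda>x es as. psum (\<lambda>a r. w es (br a x # r)) as) (x # es) as =
     psum (\<lambda>a r. w es (br a x # r)) as - alt (\<lambda>y es as. psum (\<lambda>a r. w (x # es) (br a y # r)) as) es as"
    by (simp add: alt_def sum.lessThan_Suc_shift nths_Cons_omit sum_negf del: sum.lessThan_Suc)
  ultimately show "contract x (D w) es as = (Lie x w - D (contract x w)) es as"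
    using as by (simp add: contract_def[of x "D w"] D_def Lie_def d_Leibniz_Cons) (simp add: contract_def algebra_simps)
qed (simp_all add: off_simps)

text \<open>The terms that do not keep \<open>b\<close> as an argument from \<open>H\<close> are the
  one where \<delta> moves it among the arguments from \<open>E\<close>, and those where d' replaces
  it by \<open>br b x\<close>.\<close>

lemma contract_H_D:
  assumes w: "cochain_cond w" and b: "b \<in> H" shows "contract_H b (D w) = D (contract_H b w) + contract b w + alt (\<lambda>x. contract_H (br b x) w)"
proof (rule off_eqI)
  fix es as :: "'e list" assume as: "set as \<subseteq> H"
  have s: "w es (a # b # r) = w es (b # a # r)" for es a r
    by (rule hsymD[OF cochain_condD(2)[OF w]]) simp
  show "contract_H b (D w) es as = (D (contract_H b w) + contract b w + alt (\<lambda>x. contract_H (br b x) w)) es as"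
    using as b by (simp add: contract_H_def D_def psum_Cons d_Leibniz_def s contract_def alt_def V.scale_right_distrib sum.distrib)
qed (use cochain_condD[OF w] in \<open>simp_all add: off_simps\<close>)

text \<open>For an argument from \<open>E\<close>, Cartan's formula on both sides reduces the claim
  to \<open>Lie_br\<close> and the induction hypothesis.\<close>

lemma Lie_D:
  assumes "cochain_cond w" shows "Lie x (D w) = D (Lie x w)"
proof (rule operator_eqI[where P=cochain_cond and w=w and A="\<lambda>w. Lie x (D w)" and B="\<lambda>w. D (Lie x w)"])
  fix w y es as assume w: "cochain_cond w"
    and IH: "\<And>w. cochain_cond w \<Longrightarrow> Lie x (D w) es as = D (Lie x w) es as"
  have "contract y (Lie x (D w)) = Lie x (Lie y w) - Lie x (D (contract y w)) - (Lie (br x y) w - D (contract (br x y) w))"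
    by (simp add: contract_Lie contract_D w Lie_linear)
  moreover have "contract y (D (Lie x w)) = Lie y (Lie x w) - D (Lie x (contract y w)) + D (contract (br x y) w)"
    by (simp add: contract_Lie contract_D w cochain_cond_Lie D_linear cochain_condD(1))
  ultimately show "contract y (Lie x (D w)) es as = contract y (D (Lie x w)) es as"
    using IH[OF cochain_cond_contract[OF w, of y]] by (simp add: Lie_br[OF w])
next
  fix w b and as :: "'e list" assume w: "cochain_cond w" and b: "b \<in> H" and as: "set as \<subseteq> H"
    and IH: "\<And>w. cochain_cond w \<Longrightarrow> Lie x (D w) [] as = D (Lie x w) [] as"
  have o: "off w" "hsym w" "hsym (D w)" using cochain_condD[OF w] by (auto simp: hsym_D)
  have "contract_H b (Lie x (D w)) = Lie x (D (contract_H b w)) + Lie x (contract b w) + Lie x (alt (\<lambda>x. contract_H (br b x) w))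
     - (D (contract_H (br x b) w) + contract (br x b) w + alt (\<lambda>y. contract_H (br (br x b) y) w))"
    using b by (simp add: contract_H_Lie contract_H_D w Lie_linear o H_closed)
  moreover have "contract_H b (D (Lie x w)) = D (Lie x (contract_H b w)) - D (contract_H (br x b) w) + Lie x (contract b w) - contract (br x b) w
    + alt (\<lambda>y. contract_H (br b y) (Lie x w))"
    using b by (simp add: contract_H_D w cochain_cond_Lie contract_H_Lie contract_Lie o H_closed D_linear)
  \<comment> \<open>With no arguments from \<open>E\<close>, all \<open>alt\<close> terms vanish;
    \<open>Lie_alt\<close> rewrites the Lie derivative of such a term as another one.\<close>
  ultimately show "contract_H b (Lie x (D w)) [] as = contract_H b (D (Lie x w)) [] as"
    using IH[OF cochain_cond_contract_H[OF w b]] by (simp add: Lie_alt o off_simps)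
qed (simp_all add: assms Lie_Nil D_Nil)

section \<open>The differential preserves the cochain conditions\<close>

lemma contract_H_diff: "cochain_cond w \<Longrightarrow> a \<in> H \<Longrightarrow> b \<in> H \<Longrightarrow> contract_H (a - b) w = contract_H a w - contract_H b w"
  using cochain_condD(4)[of w "a - b" b] H_closed(2)[of a "- b"] H_closed(3)[of b "- 1"] by simp

lemma contract_H_0: "cochain_cond w \<Longrightarrow> contract_H 0 w = 0"
  using contract_H_diff[of w 0 0] H_closed(1) by simp

lemma contract_H_add_D:
  assumes w: "cochain_cond w" and ab: "a \<in> H" "b \<in> H" shows "contract_H (a + b) (D w) = contract_H a (D w) + contract_H b (D w)"
proof -
  have "alt (\<lambda>x. contract_H (br (a + b) x) w) = alt (\<lambda>x. contract_H (br a x) w) + alt (\<lambda>x. contract_H (br b x) w)"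
    by (simp add: br_add cochain_condD(4)[OF w] ab H_closed alt_linear)
  then show ?thesis
    by (simp add: contract_H_D cochain_condD(3,4)[OF w] w D_linear ab H_closed)
qed

text \<open>Three failures of linearity cancel: the derivative of \<open>f\<close> from
  \<open>D_fscale\<close>, the correction from inserting \<open>smult f a\<close> among the
  arguments from \<open>E\<close>, and the two extra terms of
  \<open>br (smult f a) x\<close>.\<close>

lemma contract_H_smult_D:
  assumes w: "cochain_cond w" and a: "a \<in> H" shows "contract_H (smult f a) (D w) = fscale f (contract_H a (D w))"
proof -
  have "contract_H (br (smult f a) x) w = fscale f (contract_H (br a x) w) + fscale (ip a x) (contract_H (der f) w)
      - fscale (ip x (der f)) (contract_H a w)" for x
    by (simp add: br_smult_left contract_H_diff[OF w] cochain_condD(4,6)[OF w] H_closed a)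
  then have "alt (\<lambda>x. contract_H (br (smult f a) x) w) = fscale f (alt (\<lambda>x. contract_H (br a x) w))
      + alt (\<lambda>x. fscale (ip a x) (contract_H (der f) w)) - alt (\<lambda>x. fscale (ip x (der f)) (contract_H a w))"
    by (simp only: alt_linear)
  then show ?thesis
    by (simp add: contract_H_D w a H_closed cochain_condD(1,5,6)[OF w] D_fscale off_simps fscale_linear)
qed

lemma contract_H_der_D:
  assumes w: "cochain_cond w" shows "contract_H (der f) (D w) = D (contract_H (der f) w) + contract (der f) w"
  by (simp add: contract_H_D w H_closed br_der contract_H_0 alt_linear)

text \<open>Cartan's formula applied twice gives \<open>D\<close> of the anticommutator on
  \<open>w\<close>, minus the contractions with \<open>br x y\<close> and \<open>br y x\<close>. By
  \<open>br_sym\<close> these combine to \<open>der (ip x y)\<close>, which is the defect in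
  \<open>contract_H_der_D\<close>.\<close>

lemma anticomm_D:
  assumes w: "cochain_cond w"
  shows "contract x (contract y (D w)) + contract y (contract x (D w)) = - contract_H (der (ip x y)) (D w)"
proof -
  have "contract x (contract y (D w)) + contract y (contract x (D w)) =
      D (contract x (contract y w) + contract y (contract x w)) - (contract (br x y) w + contract (br y x) w)"
    by (simp add: contract_D w cochain_cond_contract contract_linear contract_Lie cochain_condD(1)[OF w] D_linear)
  also have "contract (br x y) w + contract (br y x) w = contract (der (ip x y)) w"
    by (simp flip: cochain_condD(3)[OF w] br_sym)
  finally show ?thesis
    by (simp only: contract_anticomm[OF w] D_linear contract_H_der_D[OF w] minus_add_distrib diff_conv_add_uminus)
qed

text \<open>The base case, where the correction sum is empty. The two terms with
  \<open>ip x a\<close> and \<open>der f\<close>, one from the bracket and one from the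
  \<open>R\<close>-linearity rule for \<open>w\<close>, cancel.\<close>

lemma contract_smult_D_Nil:
  assumes w: "cochain_cond w" and as: "set as \<subseteq> H"
  shows "contract (smult f x) (D w) [] as = vmult f (contract x (D w) [] as)"
proof -
  \<comment> \<open>The last term of \<open>br_smult_left\<close> is absent, since \<open>a\<close>
    and \<open>der f\<close> both lie in the isotropic \<open>H\<close>.\<close>
  have 1: "w [] (br (smult f x) a # r) = vmult f (w [] (br x a # r)) + vmult (ip x a) (w [] (der f # r))"
    if "a \<in> H" for a r
  proof -
    have "contract_H (br (smult f x) a) w = fscale f (contract_H (br x a) w) + fscale (ip x a) (contract_H (der f) w)"
      using that by (simp add: br_smult_left H_closed cochain_condD(4,6)[OF w])
    then have "contract_H (br (smult f x) a) w [] r = (fscale f (contract_H (br x a) w) + fscale (ip x a) (contract_H (der f) w)) [] r"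
      by simp
    then show ?thesis by (simp add: contract_H_def fscale_def)
  qed
  have 2: "w [smult f x, a] r = vmult f (w [x, a] r) - vmult (ip x a) (w [] (der f # r))" for a r
  proof -
    have "contract (smult f x) w [a] r = (fscale f (contract x w) - alt (\<lambda>y. fscale (ip x y) (contract_H (der f) w))) [a] r"
      by (simp only: cochain_condD(5)[OF w])
    then show ?thesis by (simp add: contract_def contract_H_def fscale_def alt_def nths_Cons_omit)
  qed
  have p: "psum (\<lambda>a r. vmult f (F a r)) as = vmult f (psum F as)" for F and as :: "'e list"
    by (simp add: psum_def V.scale_sum_right)
  have "psum (\<lambda>a r. w [] (br (smult f x) a # r) + w [smult f x, a] r) as =
      psum (\<lambda>a r. vmult f (w [] (br x a # r) + w [x, a] r)) as"
    by (rule psum_cong) (use as in \<open>auto simp: 1 2 V.scale_right_distrib\<close>)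
  then have "- (psum (\<lambda>a r. w [] (br (smult f x) a # r)) as + psum (\<lambda>a. w [smult f x, a]) as) =
      - vmult f (psum (\<lambda>a r. w [] (br x a # r)) as + psum (\<lambda>a. w [x, a]) as)"
    by (simp only: psum_add p)
  then have "- psum (\<lambda>a r. w [] (br (smult f x) a # r)) as - psum (\<lambda>a. w [smult f x, a]) as =
      - vmult f (psum (\<lambda>a r. w [] (br x a # r)) as) - vmult f (psum (\<lambda>a. w [x, a]) as)"
    by (simp only: V.scale_right_distrib minus_add_distrib diff_conv_add_uminus)
  then show ?thesis
    using as by (simp add: contract_D w D_Nil Lie_def nabla_smult V.scale_right_diff_distrib V.scale_right_distrib
        diff_diff_eq) (simp add: contract_def)
qed

text \<open>Induction on the arguments from \<open>E\<close>. Moving the contraction with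
  \<open>z\<close> inwards by anticommutation and Cartan's formula leaves the claim for
  \<open>contract z w\<close>, the known rule for the cochain \<open>Lie z w\<close>, and a term in
  \<open>der (f * ip x z)\<close>.\<close>

lemma contract_smult_D:
  assumes w: "cochain_cond w"
  shows "contract (smult f x) (D w) = fscale f (contract x (D w)) - alt (\<lambda>y. fscale (ip x y) (contract_H (der f) (D w)))"
proof -
  define R where "R w = fscale f (contract x (D w)) - alt (\<lambda>y. fscale (ip x y) (contract_H (der f) (D w)))" for w
  have "contract (smult f x) (D w) es as = R w es as" if "cochain_cond w" "set as \<subseteq> H" for w es as
    using that
  proof (induction es arbitrary: w)
    case Nil
    then show ?case by (simp add: R_def contract_smult_D_Nil fscale_def)
  next
    case (Cons z es)
    note w = \<open>cochain_cond w\<close>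
    \<comment> \<open>This term arises from moving \<open>z\<close> past \<open>smult f x\<close>.
      The derivation rule splits it into the anticommutation term for \<open>x\<close> and the
      summand of the correction belonging to \<open>z\<close>.\<close>
    define h where "h = contract_H (der (f * ip x z)) (D w)"
    have h: "h = fscale f (contract_H (der (ip x z)) (D w)) + fscale (ip x z) (contract_H (der f) (D w))"
      by (simp add: h_def der_mult contract_H_add_D contract_H_smult_D w H_closed)
    have swap: "contract z (contract y (D w)) = contract y (D (contract z w)) - contract y (Lie z w) - contract_H (der (ip y z)) (D w)" for y
    proof -
      have "contract z (contract y (D w)) = (contract y (contract z (D w)) + contract z (contract y (D w))) - contract y (contract z (D w))"
        by simp
      also have "\<dots> = - contract_H (der (ip y z)) (D w) - contract y (Lie z w - D (contract z w))"
        by (simp only: anticomm_D[OF w]) (simp only: contract_D[OF w, of z])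
      finally show ?thesis
        by (simp add: contract_linear)
    qed
    have 1: "contract z (contract (smult f x) (D w)) = contract (smult f x) (D (contract z w)) - contract (smult f x) (Lie z w) - h"
      by (simp only: swap[of "smult f x"] h_def ip_smult_left)
    have "contract z (R w) = fscale f (contract z (contract x (D w))) - fscale (ip x z) (contract_H (der f) (D w))
        + alt (\<lambda>y. fscale (ip x y) (contract_H (der f) (contract z (D w))))"
      by (simp only: R_def contract_linear fscale_contract contract_alt contract_H_contract diff_diff_eq2 add_diff_eq diff_add_eq)
    also have "alt (\<lambda>y. fscale (ip x y) (contract_H (der f) (contract z (D w)))) =
        alt (\<lambda>y. fscale (ip x y) (contract_H (der f) (Lie z w))) - alt (\<lambda>y. fscale (ip x y) (contract_H (der f) (D (contract z w))))"
      by (simp only: contract_D[OF w] contract_H_linear fscale_linear alt_linear)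
    also have "fscale f (contract z (contract x (D w))) = fscale f (contract x (D (contract z w))) - fscale f (contract x (Lie z w))
        - fscale f (contract_H (der (ip x z)) (D w))"
      by (simp only: swap[of x] fscale_linear)
    finally have eq: "contract z (R w) = fscale f (contract x (D (contract z w))) - fscale f (contract x (Lie z w))
        - fscale f (contract_H (der (ip x z)) (D w)) - fscale (ip x z) (contract_H (der f) (D w))
        + (alt (\<lambda>y. fscale (ip x y) (contract_H (der f) (Lie z w))) - alt (\<lambda>y. fscale (ip x y) (contract_H (der f) (D (contract z w)))))" .
    have "contract z (R w) = R (contract z w) - contract (smult f x) (Lie z w) - h"
      unfolding eq by (simp only: h R_def cochain_condD(5)[OF cochain_cond_Lie[OF w]]) (simp only: algebra_simps)
    with 1 Cons.IH[OF cochain_cond_contract[OF w]] Cons.prems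
    have "contract z (contract (smult f x) (D w)) es as = contract z (R w) es as"
      by simp
    then show ?case by (simp only: contract_def)
  qed
  with w show ?thesis
    unfolding R_def by (intro off_eqI off_simps off_D) auto
qed

lemma first_cond_D:
  assumes w: "cochain_cond w" shows "first_cond (D w)"
  unfolding first_cond_def
proof (intro conjI allI ballI)
  show "contract (x + y) (D w) = contract x (D w) + contract y (D w)" for x y
    by (simp add: contract_D w cochain_condD(3)[OF w] Lie_add D_linear)
qed (simp_all only: off_D hsym_D cochain_condD(2) contract_H_add_D contract_H_smult_D anticomm_D contract_smult_D w)

lemma cochain_cond_D: "cochain_cond w \<Longrightarrow> cochain_cond (D w)"
\<comment> \<open>By Cartan's formula a contraction of \<open>D v\<close> is again of the form
  \<open>D v' + w'\<close>, with \<open>v' = - contract y v\<close> and the Lie derivative absorbed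
  into \<open>w'\<close>.\<close>
proof (rule cochain_cond_coinduct[where X="\<lambda>u. \<exists>v w. u = D v + w \<and> cochain_cond v \<and> cochain_cond w"])
  fix u y assume "\<exists>v w. u = D v + w \<and> cochain_cond v \<and> cochain_cond w"
  then obtain v w where u: "u = D v + w" "cochain_cond v" "cochain_cond w" by blast
  then show "first_cond u" by (simp add: first_cond_add first_cond_D cochain_cond_first_cond)
  have "contract y u = D (- contract y v) + (Lie y v + contract y w)"
    using u by (simp add: contract_linear contract_D D_linear)
  then show "\<exists>v w. contract y u = D v + w \<and> cochain_cond v \<and> cochain_cond w"
    using u cochain_cond_contract cochain_cond_uminus cochain_cond_add cochain_cond_Lie by blast
qed (intro exI[of _ w] exI[of _ 0], simp add: cochain_cond_0)

text \<open>Cartan's formula and \<open>Lie_D\<close> let contractions pass through the square, so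
  arguments from \<open>E\<close> can be removed. For an argument \<open>b\<close> from
  \<open>H\<close>, the mixed terms \<open>D (contract b w)\<close> and
  \<open>contract b (D w)\<close> add up to \<open>Lie b w\<close>.\<close>

lemma D_D:
  assumes "cochain_cond w" shows "D (D w) = 0"
proof (rule operator_eqI[where P=cochain_cond and w=w and A="\<lambda>w. D (D w)" and B="\<lambda>w. 0"])
  fix w x es as assume w: "cochain_cond w" and IH: "\<And>w. cochain_cond w \<Longrightarrow> D (D w) es as = 0 es as"
  have "contract x (D (D w)) = D (D (contract x w))"
    by (simp add: contract_D cochain_cond_D w D_linear Lie_D)
  then show "contract x (D (D w)) es as = contract x 0 es as"
    using IH[OF cochain_cond_contract[OF w]] by (simp add: contract_linear)
next
  fix w b and as :: "'e list" assume w: "cochain_cond w" and b: "b \<in> H" and as: "set as \<subseteq> H"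
    and IH: "\<And>w. cochain_cond w \<Longrightarrow> D (D w) [] as = 0 [] as"
  define A where "A = alt (\<lambda>x. contract_H (br b x) w)"
  have "A [a] = (\<lambda>r. w [] (br b a # r))" for a
    by (simp add: A_def alt_def contract_H_def nths_Cons_omit fun_eq_iff)
  \<comment> \<open>Since \<open>nabla b\<close> is zero and no arguments from \<open>E\<close> are
    left, \<open>Lie b w\<close> consists only of the action on the arguments from \<open>H\<close>,
    which is the negative of \<delta> applied to \<open>A\<close>.\<close>
  then have "D A [] as = - Lie b w [] as"
    using as b by (simp add: D_Nil Lie_def nabla_H)
  moreover have "contract_H b (D (D w)) = D (D (contract_H b w)) + D A + Lie b w + alt (\<lambda>x. contract_H (br b x) (D w))"
    unfolding A_def using b by (simp add: contract_H_D[OF cochain_cond_D[OF w]] contract_H_D[OF w] contract_D w D_linear)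
  ultimately show "contract_H b (D (D w)) [] as = contract_H b 0 [] as"
    using IH[OF cochain_cond_contract_H[OF w b]] by (simp add: contract_H_linear)
qed (simp_all add: assms D_Nil off_simps)

subsection \<open>The cochain complex\<close>

definition flat :: "('e, 'v) cochain \<Rightarrow> 'e list \<Rightarrow> 'e list \<Rightarrow> 'v" where
  "flat \<omega> = (\<lambda>es as. \<omega> (length as) es as)"

definition supported :: "nat \<Rightarrow> ('e, 'v) cochain \<Rightarrow> bool" where
  "supported n \<omega> \<longleftrightarrow> (\<forall>k es as. (es, as) \<notin> args H n k \<longrightarrow> \<omega> k es as = 0)"

abbreviation C :: "nat \<Rightarrow> ('e, 'v) cochain set" where
  "C n \<equiv> cochains scale smult ip der H vmult n"

lemma supported_C: "\<omega> \<in> C n \<Longrightarrow> supported n \<omega>"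
  by (simp add: cochains_def symmetric_multilinear_def supported_def)

text \<open>Where a supported cochain can be nonzero, its index is the length of the second list, so
  \<open>flat\<close> loses no information.\<close>

lemma supported_eqI:
  assumes "supported n \<omega>" "supported n \<eta>" "flat \<omega> = flat \<eta>"
  shows "\<omega> = \<eta>"
proof (intro ext)
  fix k es as
  have "\<omega> (length as) es as = \<eta> (length as) es as"
    using fun_cong[OF fun_cong[OF assms(3)]] by (simp add: flat_def)
  then show "\<omega> k es as = \<eta> k es as"
    using assms(1,2) unfolding supported_def args_def by (cases "k = length as") auto
qed

section \<open>Translation between indexed cochains and recursive conditions\<close>

text \<open>Position \<open>b\<close> of \<open>es\<close> is position
  \<open>length p + 1 + b\<close> of the full list. The extra \<open>1\<close> accounts for the
  minus sign.\<close>

lemma alt_smult: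
  "alt (\<lambda>y. fscale (ip x y) (contract_H (der f) (pre p w))) es as =
     - (\<Sum>b\<in>{length p<..<length (p @ x # es)}. vmult ((-1) ^ (b - length p) * ip ((p @ x # es) ! length p) ((p @ x # es) ! b))
          (w (nths (p @ x # es) (- {length p, b})) (der f # as)))"
proof -
  have "(\<Sum>b\<in>{length p<..<length (p @ x # es)}. G b) = (\<Sum>b<length es. G (Suc (length p + b)))" for G :: "nat \<Rightarrow> 'v"
    by (rule sum.reindex_bij_witness[of _ "\<lambda>b. Suc (length p + b)" "\<lambda>b. b - Suc (length p)"]) auto
  then show ?thesis
    by (simp add: alt_def fscale_def contract_H_def pre_def nths_omit2 nth_append sum_negf)
qed

text \<open>After a prefix \<open>p\<close> has been fixed, a condition at position
  \<open>length p\<close> becomes one at the first position. Outside the domain of degree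
  \<open>n\<close> both sides are zero.\<close>

lemma cochain_cond_flat:
  assumes \<omega>: "\<omega> \<in> C n" shows "cochain_cond (flat \<omega>)"
  unfolding cochain_cond_def
proof
  fix p
  define w where "w = pre p (flat \<omega>)"
  have w: "w es as = \<omega> (length as) (p @ es) as" for es as
    by (simp add: w_def pre_def flat_def)
  have zero: "w es as = 0" if "\<not> (2 * length as + length p + length es = n \<and> set as \<subseteq> H)" for es as
    using supported_C[OF \<omega>] that by (auto simp: w supported_def args_def)
  have dom: "(p @ es, as) \<in> args H n (length as)" if "2 * length as + length p + length es = n" "set as \<subseteq> H" for es as
    using that by (auto simp: args_def)
  note q = \<omega>[unfolded cochains_def, THEN CollectD]
  note M = q[THEN conjunct1]
  note c = q[THEN conjunct2, THEN spec, THEN bspec[where x="(es, as)" for es as], unfolded prod.case]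
  note m = M[unfolded symmetric_multilinear_def, THEN conjunct2, THEN spec, THEN bspec[where x="(es, as)" for es as], unfolded prod.case]
  note anti = c[THEN conjunct1, rule_format]
  note smu = c[THEN conjunct2, THEN conjunct1, rule_format]
  note hsmu = c[THEN conjunct2, THEN conjunct2, rule_format]
  note lin = m[THEN conjunct1, rule_format]
  note hadd = m[THEN conjunct2, THEN conjunct1, rule_format]
  note symm = m[THEN conjunct2, THEN conjunct2, THEN conjunct2, rule_format]
  show "first_cond w"
    unfolding first_cond_def
  proof (intro conjI allI ballI)
    show "off w"
      unfolding off_def using zero by blast
    show "hsym w"
    proof (rule hsymI)
      fix es as bs assume eq: "mset as = mset (bs :: 'e list)"
      have l: "length as = length bs" "set as = set bs"
        using mset_eq_length[OF eq] mset_eq_setD[OF eq] .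
      show "w es as = w es bs"
      proof (cases "2 * length bs + length p + length es = n \<and> set bs \<subseteq> H")
        case True
        then show ?thesis using symm[OF dom eq] l by (simp add: w)
      qed (simp add: zero l)
    qed
    fix x y f
    show "contract (x + y) w = contract x w + contract y w"
    proof (intro ext)
      fix es as
      show "contract (x + y) w es as = (contract x w + contract y w) es as"
      proof (cases "2 * length as + length p + length (x # es) = n \<and> set as \<subseteq> H")
        case True
        then show ?thesis using linear_add[OF lin[OF dom[of as "x # es"], of "length p"], of x y]
          by (simp add: contract_def w)
      qed (simp add: contract_def zero)
    qed
    show "contract x (contract y w) + contract y (contract x w) = - contract_H (der (ip x y)) w"
    proof (intro ext)
      fix es as
      show "(contract x (contract y w) + contract y (contract x w)) es as = (- contract_H (der (ip x y)) w) es as"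
      proof (cases "2 * length as + length p + length (y # x # es) = n \<and> set as \<subseteq> H")
        case True
        \<comment> \<open>\<open>contract x (contract y w)\<close> places \<open>y\<close> before
          \<open>x\<close>, hence the order of this list.\<close>
        then show ?thesis using anti[OF dom[of as "y # x # es"], of "length p"]
          by (simp add: contract_def contract_H_def w nths_omit2[where b=0, simplified] nths_Cons_omit list_update_append nth_append ip_sym[of y x])
      qed (simp add: contract_def contract_H_def zero)
    qed
    show "contract (smult f x) w = fscale f (contract x w) - alt (\<lambda>y. fscale (ip x y) (contract_H (der f) w))"
    proof (intro ext)
      fix es as
      show "contract (smult f x) w es as = (fscale f (contract x w) - alt (\<lambda>y. fscale (ip x y) (contract_H (der f) w))) es as"
      proof (cases "2 * length as + length p + length (x # es) = n \<and> set as \<subseteq> H")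
        case True
        then have "contract (smult f x) w es as = fscale f (contract x w) es as - alt (\<lambda>y. fscale (ip x y) (contract_H (der f) w)) es as"
          using smu[OF dom[of as "x # es"], of "length p" f]
          unfolding w_def alt_smult by (simp add: contract_def fscale_def pre_def flat_def)
        then show ?thesis by simp
      next
        case False
        \<comment> \<open>The correction trades two arguments from \<open>E\<close> for one from
          \<open>H\<close>, so it has the same degree as \<open>x # es\<close> with
          \<open>as\<close> and lies outside the domain as well.\<close>
        then have "vmult (ip x (es ! b)) (w (nths es (- {b})) (der f # as)) = 0" if "b < length es" for b
          using length_nths_omit[OF that] by (subst zero) auto
        with False show ?thesis
          by (simp add: contract_def contract_H_def fscale_def alt_def zero)
      qed
    qed
  next
    fix a b f assume a: "a \<in> H"
    show "contract_H (smult f a) w = fscale f (contract_H a w)"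
    proof (intro ext)
      fix es as
      show "contract_H (smult f a) w es as = fscale f (contract_H a w) es as"
      proof (cases "2 * length (a # as) + length p + length es = n \<and> set (a # as) \<subseteq> H")
        case True
        then show ?thesis using hsmu[OF dom[of "a # as" es], of 0 f]
          by (simp add: contract_H_def fscale_def w)
      next
        case False
        with a show ?thesis by (simp add: contract_H_def fscale_def zero)
      qed
    qed
    assume b: "b \<in> H"
    show "contract_H (a + b) w = contract_H a w + contract_H b w"
    proof (intro ext)
      fix es as
      show "contract_H (a + b) w es as = (contract_H a w + contract_H b w) es as"
      proof (cases "2 * length (a # as) + length p + length es = n \<and> set (a # as) \<subseteq> H")
        case True
        then show ?thesis using hadd[OF dom[of "a # as" es], of 0 a b] a b
          by (simp add: contract_H_def w)
      next
        case False
        with a show ?thesis by (simp add: contract_H_def zero)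
      qed
    qed
  qed
qed

lemma cochain_cond_pre: "cochain_cond w \<Longrightarrow> cochain_cond (pre p w)"
  by (induction p arbitrary: w) (simp_all add: pre_Cons cochain_cond_contract)

text \<open>A derivation kills constants, so the \<open>R\<close>-linearity rule has no correction
  for scalars. Linearity over the ground field is thus already contained in
  \<open>cochain_cond\<close>.\<close>

lemma der_scalar [simp]: "der (scale c 1) = 0"
proof -
  have "der 1 + der 1 = der 1 + 0"
    using der_mult[of 1 1] by simp
  then have "der 1 = 0"
    by (rule add_left_imp_eq)
  then show ?thesis
    using der_linear by (simp add: Vector_Spaces.linear_iff ground_scale_def)
qed

text \<open>A position in \<open>es\<close> becomes the first one after the arguments before it are
  fixed by \<open>pre\<close>; a position in \<open>as\<close> is moved to the front by symmetry, as
  recorded in \<open>upd\<close>.\<close>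

lemma C_I:
  assumes supp: "supported n \<omega>" and cochain_cond: "cochain_cond (flat \<omega>)"
  shows "\<omega> \<in> C n"
proof -
  have upd: "\<omega> k es (as[i := z]) = contract_H z (flat \<omega>) es (nths as (- {i}))"
    if "(es, as) \<in> args H n k" "i < k" for k es as i z
  proof -
    have "length as = k" using that by (simp add: args_def)
    moreover have "flat \<omega> es (as[i := z]) = flat \<omega> es (z # nths as (- {i}))"
      using that \<open>length as = k\<close> by (intro hsymD[OF cochain_condD(2)[OF cochain_cond]] mset_update_omit) simp
    ultimately show ?thesis by (simp add: flat_def contract_H_def)
  qed
  have split: "\<exists>p r. es = p @ es ! a # r \<and> length p = a" if "a < length es" for es :: "'e list" and a
    using id_take_nth_drop[OF that] that by (metis length_take min.absorb4)
  note hadd = cochain_condD(4)[OF cochain_cond] and hscale = cochain_condD(6)[OF cochain_cond]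
  have gs: "ground_scale scale smult c x = smult (scale c 1) x" "ground_scale scale vmult c v = vmult (scale c 1) v" for c x v
    by (simp_all add: ground_scale_def)
  note vs = vector_space_ground_scale[OF R.commutative_algebra_axioms]
  have 1: "Vector_Spaces.linear (ground_scale scale smult) (ground_scale scale vmult) (\<lambda>x. \<omega> k (es[a := x]) as)"
    if "(es, as) \<in> args H n k" "a < length es" for k es as a
  proof -
    obtain p r where es: "es = p @ es ! a # r" "length p = a"
      using split[OF \<open>a < length es\<close>] by blast
    define w where "w = pre p (flat \<omega>)"
    have w: "cochain_cond w" unfolding w_def by (rule cochain_cond_pre[OF cochain_cond])
    have eq: "\<omega> k (es[a := x]) as = contract x w r as" for x
    proof -
      have "es[a := x] = p @ x # r"
        by (subst es(1)) (simp flip: es(2))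
      moreover have "k = length as" using that by (simp add: args_def)
      ultimately show ?thesis by (simp add: w_def pre_def contract_def flat_def)
    qed
    have "contract (x + y) w r as = contract x w r as + contract y w r as" for x y
      by (simp add: cochain_condD(3)[OF w])
    moreover have "contract (smult (scale c 1) x) w r as = vmult (scale c 1) (contract x w r as)" for c x
    proof -
      have "contract (smult (scale c 1) x) w = fscale (scale c 1) (contract x w)"
        by (simp add: cochain_condD(5)[OF w] contract_H_0[OF w] fscale_linear alt_linear)
      then show ?thesis by (simp add: fscale_def)
    qed
    ultimately show ?thesis
      unfolding eq by (simp add: Vector_Spaces.linear_iff vs E.module_axioms V.module_axioms gs)
  qed
  have 2: "\<omega> k es (as[i := x + y]) = \<omega> k es (as[i := x]) + \<omega> k es (as[i := y])"
    if "(es, as) \<in> args H n k" "i < k" "x \<in> H" "y \<in> H" for k es as i x y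
    using that(3,4) by (simp add: upd[OF that(1,2)] hadd)
  have 3: "\<omega> k es (as[i := ground_scale scale smult c x]) = ground_scale scale vmult c (\<omega> k es (as[i := x]))"
    if "(es, as) \<in> args H n k" "i < k" "x \<in> H" for k es as i x c
    using that(3) by (simp add: upd[OF that(1,2)] hscale gs fscale_def)
  have 4: "\<omega> k es bs = \<omega> k es as" if "(es, as) \<in> args H n k" "mset bs = mset as" for k es as bs
    using hsymD[OF cochain_condD(2)[OF cochain_cond] that(2), of es] mset_eq_length[OF that(2)] that(1)
    by (simp add: flat_def args_def)
  have 5: "\<omega> k es as + \<omega> k (es[a := es ! Suc a, Suc a := es ! a]) as =
             - \<omega> (Suc k) (nths es (- {a, Suc a})) (der (ip (es ! a) (es ! Suc a)) # as)"
    if "(es, as) \<in> args H n k" "Suc a < length es" for k es as a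
  proof -
    obtain p r' where es': "es = p @ es ! a # r'" "length p = a"
      using split[OF Suc_lessD[OF \<open>Suc a < length es\<close>]] by blast
    have "r' \<noteq> []"
      using arg_cong[OF es'(1), of length] es'(2) \<open>Suc a < length es\<close> by auto
    then obtain y r where r: "r' = y # r"
      by (auto simp: neq_Nil_conv)
    define x where "x = es ! a"
    have es: "es = p @ x # y # r" using es' r by (simp add: x_def)
    have k: "k = length as" using that by (simp add: args_def)
    define w where "w = pre p (flat \<omega>)"
    have w: "cochain_cond w" unfolding w_def by (rule cochain_cond_pre[OF cochain_cond])
    have "(contract y (contract x w) + contract x (contract y w)) r as = (- contract_H (der (ip y x)) w) r as"
      by (simp only: contract_anticomm[OF w])
    then show ?thesis
      by (simp add: es k w_def pre_def contract_def contract_H_def flat_def ip_sym[of y x] list_update_append nth_append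
          nths_omit2[where b=0, simplified] nths_Cons_omit flip: es'(2))
  qed
  have 6: "\<omega> k (es[a := smult f (es ! a)]) as = vmult f (\<omega> k es as) +
             (\<Sum>b\<in>{a<..<length es}. vmult ((-1) ^ (b - a) * ip (es ! a) (es ! b))
                (\<omega> (Suc k) (nths es (- {a, b})) (der f # as)))"
    if "(es, as) \<in> args H n k" "a < length es" for k es as a f
  proof -
    obtain p r where es': "es = p @ es ! a # r" "length p = a"
      using split[OF \<open>a < length es\<close>] by blast
    define x where "x = es ! a"
    have es: "es = p @ x # r" using es'(1) by (simp add: x_def)
    have k: "k = length as" using that by (simp add: args_def)
    define w where "w = pre p (flat \<omega>)"
    have w: "cochain_cond w" unfolding w_def by (rule cochain_cond_pre[OF cochain_cond])
    have "contract (smult f x) w r as = fscale f (contract x w) r as - alt (\<lambda>y. fscale (ip x y) (contract_H (der f) w)) r as"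
      by (simp add: cochain_condD(5)[OF w])
    then show ?thesis
      unfolding w_def alt_smult es es'(2)[THEN HOL.sym] k
      by (simp add: pre_def contract_def fscale_def flat_def)
  qed
  have 7: "\<omega> k es (as[i := smult f (as ! i)]) = vmult f (\<omega> k es as)"
    if "(es, as) \<in> args H n k" "i < k" for k es as i f
  proof -
    have "as ! i \<in> H" using that by (auto simp: args_def)
    then have "\<omega> k es (as[i := smult f (as ! i)]) = vmult f (\<omega> k es (as[i := as ! i]))"
      unfolding upd[OF that] by (simp add: hscale fscale_def)
    then show ?thesis by simp
  qed
  have 8: "\<omega> k es as = 0" if "(es, as) \<notin> args H n k" for k es as
    using supp that by (simp add: supported_def)
  show ?thesis
    unfolding cochains_def symmetric_multilinear_def mem_Collect_eq Ball_def split_paired_All prod.case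
    by (intro conjI allI impI; rule 1 2 3 4 5 6 7 8; assumption)
qed

section \<open>The differential on indexed cochains\<close>

text \<open>Symmetry is needed because \<open>d_prime\<close> changes an argument from
  \<open>H\<close> in place, whereas \<open>D\<close> puts the changed argument in front.\<close>

lemma flat_differential:
  assumes "hsym (flat \<omega>)"
  shows "flat (differential br H vmult nabla \<omega>) = D (flat \<omega>)"
proof (intro ext)
  fix es as
  have "d_Leibniz br vmult nabla \<omega> (length as) es as = d_Leibniz br vmult nabla (\<lambda>k. flat \<omega>) 0 es as"
    by (simp add: d_Leibniz_def flat_def)
  moreover have "d_delta \<omega> (length as) es as = psum (\<lambda>a. flat \<omega> (a # es)) as"
  proof -
    have "length as - 1 = length (nths as (- {i}))" if "i < length as" for i
      using length_nths_omit[OF that] by simp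
    then show ?thesis
      by (auto simp: d_delta_def psum_def flat_def intro!: sum.cong)
  qed
  moreover have "d_prime br vmult \<omega> (length as) es as = alt (\<lambda>x es as. psum (\<lambda>a r. flat \<omega> es (br a x # r)) as) es as"
  proof -
    have "\<omega> (length as) es (as[i := x]) = flat \<omega> es (x # nths as (- {i}))" if "i < length as" for es i x
      using hsymD[OF assms mset_update_omit[OF that], of es x] by (simp add: flat_def)
    then show ?thesis
      by (simp add: d_prime_def alt_def psum_def V.scale_sum_right)
  qed
  ultimately show "flat (differential br H vmult nabla \<omega>) es as = D (flat \<omega>) es as"
    by (simp add: flat_def[of "differential br H vmult nabla \<omega>"] differential_def D_def)
qed

lemma supported_differential:
  assumes "supported n \<omega>"
  shows "supported (Suc n) (differential br H vmult nabla \<omega>)"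
  unfolding supported_def
proof (intro allI impI)
  fix k es as assume *: "(es, as) \<notin> args H (Suc n) k"
  have zero: "\<omega> k es as = 0" if "2 * k + length es \<noteq> n \<or> length as \<noteq> k" for k es as
    using assms that by (auto simp: supported_def args_def)
  show "differential br H vmult nabla \<omega> k es as = 0"
  proof (cases "set as \<subseteq> H")
    case True
    with * have k: "2 * k + length es \<noteq> Suc n \<or> length as \<noteq> k"
      by (auto simp: args_def)
    have 1: "\<omega> k (nths fs (- {a})) bs = 0" if "a < length fs" "length fs = length es" "length bs = length as" for a fs bs
      using k length_nths_omit[OF that(1)] that by (intro zero) auto
    \<comment> \<open>The case \<open>k = 0\<close> is excluded because \<open>k - 1\<close> is
      truncated subtraction.\<close>
    have 2: "\<omega> (k - 1) (x # es) (nths as (- {i})) = 0" if "i < length as" "k \<noteq> 0" for i x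
      using k length_nths_omit[OF that(1)] that(2) by (intro zero) auto
    have "d_Leibniz br vmult nabla \<omega> k es as = 0"
      unfolding d_Leibniz_def by (simp add: 1)
    moreover have "d_delta \<omega> k es as = 0"
      unfolding d_delta_def by (simp add: 2 del: One_nat_def)
    moreover have "d_prime br vmult \<omega> k es as = 0"
      unfolding d_prime_def by (simp add: 1)
    ultimately show ?thesis by (simp add: differential_def)
  qed (simp add: differential_def)
qed

section \<open>Linear structure and the complex property\<close>

lemma flat_linear: "flat (\<omega> + \<eta>) = flat \<omega> + flat \<eta>" "flat 0 = 0"
  "flat (cochain_scale scale vmult c \<omega>) = fscale (scale c 1) (flat \<omega>)"
  by (simp_all add: flat_def fun_eq_iff cochain_scale_def fscale_def ground_scale_def)

lemma supported_linear: "supported n \<omega> \<Longrightarrow> supported n \<eta> \<Longrightarrow> supported n (\<omega> + \<eta>)" "supported n 0"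
  "supported n \<omega> \<Longrightarrow> supported n (cochain_scale scale vmult c \<omega>)"
  by (auto simp: supported_def cochain_scale_def ground_scale_def)

lemma first_cond_fscale:
  assumes "first_cond w" shows "first_cond (fscale f w)"
proof -
  have c: "contract x (contract y (fscale f w)) + contract y (contract x (fscale f w)) = fscale f (contract x (contract y w) + contract y (contract x w))" for x y
    by (simp only: fscale_contract fscale_linear)
  show ?thesis unfolding first_cond_def c
    using assms unfolding first_cond_def
    by (simp add: off_simps hsym_simps fscale_contract fscale_contract_H fscale_linear mult.commute flip: alt_linear(5))
qed

lemma cochain_cond_fscale: "cochain_cond w \<Longrightarrow> cochain_cond (fscale f w)"
  unfolding cochain_cond_def pre_linear using first_cond_fscale by blast

lemma C_linear:
  "0 \<in> C n" "\<omega> \<in> C n \<Longrightarrow> \<eta> \<in> C n \<Longrightarrow> \<omega> + \<eta> \<in> C n"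
  "\<omega> \<in> C n \<Longrightarrow> cochain_scale scale vmult c \<omega> \<in> C n"
  by (intro C_I; simp add: supported_linear supported_C flat_linear cochain_cond_flat cochain_cond_add cochain_cond_fscale cochain_cond_0)+

lemma flat_differential_C: "\<omega> \<in> C n \<Longrightarrow> flat (differential br H vmult nabla \<omega>) = D (flat \<omega>)"
  by (intro flat_differential cochain_condD(2) cochain_cond_flat)

lemma differential_add:
  assumes "\<omega> \<in> C n" "\<eta> \<in> C n"
  shows "differential br H vmult nabla (\<omega> + \<eta>) = differential br H vmult nabla \<omega> + differential br H vmult nabla \<eta>"
proof (rule supported_eqI[of "Suc n"])
  show "flat (differential br H vmult nabla (\<omega> + \<eta>)) = flat (differential br H vmult nabla \<omega> + differential br H vmult nabla \<eta>)"
    by (simp only: flat_differential_C[OF C_linear(2)[OF assms]] flat_differential_C[OF assms(1)]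
        flat_differential_C[OF assms(2)] flat_linear D_linear)
qed (intro supported_linear supported_differential supported_C[OF assms(1)] supported_C[OF assms(2)])+

lemma ip_0 [simp]: "ip x 0 = 0"
  using ip_add[of x 0 0] by simp

lemma differential_scale:
  assumes "\<omega> \<in> C n"
  shows "differential br H vmult nabla (cochain_scale scale vmult c \<omega>) = cochain_scale scale vmult c (differential br H vmult nabla \<omega>)"
proof (rule supported_eqI[of "Suc n"])
  \<comment> \<open>The extra term of \<open>D_fscale\<close> contains
    \<open>der (scale c 1)\<close>, which is zero.\<close>
  have "D (fscale (scale c 1) (flat \<omega>)) = fscale (scale c 1) (D (flat \<omega>))"
    using cochain_condD(1)[OF cochain_cond_flat[OF assms]] by (simp add: D_fscale fscale_linear alt_linear)
  then show "flat (differential br H vmult nabla (cochain_scale scale vmult c \<omega>)) =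
      flat (cochain_scale scale vmult c (differential br H vmult nabla \<omega>))"
    by (simp only: flat_differential_C[OF C_linear(3)[OF assms]] flat_differential_C[OF assms] flat_linear)
qed (intro supported_linear supported_differential supported_C[OF assms])+

lemma differential_C:
  assumes "\<omega> \<in> C n" shows "differential br H vmult nabla \<omega> \<in> C (Suc n)"
  by (intro C_I supported_differential supported_C[OF assms])
    (simp only: flat_differential_C[OF assms] cochain_cond_D[OF cochain_cond_flat[OF assms]])

lemma differential_differential:
  assumes "\<omega> \<in> C n" shows "differential br H vmult nabla (differential br H vmult nabla \<omega>) = 0"
proof (rule supported_eqI[of "Suc (Suc n)"])
  show "flat (differential br H vmult nabla (differential br H vmult nabla \<omega>)) = flat 0"
    by (simp only: flat_differential_C[OF differential_C[OF assms]] flat_differential_C[OF assms]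
        D_D[OF cochain_cond_flat[OF assms]] flat_linear)
qed (intro supported_linear supported_differential supported_C[OF assms])+

lemma cochain_complex_C:
  "cochain_complex (cochain_scale scale vmult) C (differential br H vmult nabla)"
proof -
  interpret G: vector_space "ground_scale scale vmult"
    by (rule vector_space_ground_scale[OF R.commutative_algebra_axioms V.module_axioms])
  interpret S: vector_space "cochain_scale scale vmult :: 'k \<Rightarrow> ('e, 'v) cochain \<Rightarrow> ('e, 'v) cochain"
    by unfold_locales
      (simp_all add: cochain_scale_def fun_eq_iff G.scale_right_distrib G.scale_left_distrib)
  show ?thesis
    unfolding cochain_complex_def S.subspace_def
    by (intro conjI allI ballI S.vector_space_axioms image_subsetI C_linear differential_add differential_scale
        differential_C differential_differential)
qed

end

theorem theorem3p3:
  fixes scale :: "'k::real_or_complex \<Rightarrow> 'r::comm_ring_1 \<Rightarrow> 'r"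
    and smult :: "'r \<Rightarrow> 'e::ab_group_add \<Rightarrow> 'e"
    and ip :: "'e \<Rightarrow> 'e \<Rightarrow> 'r"
    and der :: "'r \<Rightarrow> 'e"
    and br :: "'e \<Rightarrow> 'e \<Rightarrow> 'e"
    and H :: "'e set"
    and vmult :: "'r \<Rightarrow> 'v::ab_group_add \<Rightarrow> 'v"
    and nabla :: "'e \<Rightarrow> 'v \<Rightarrow> 'v"
  assumes "courant_dorfman_algebra scale smult ip der br"
    and "module.subspace smult H"
    and "range der \<subseteq> H"
    and "isotropic_ideal ip br H"
    and "H_representation scale smult ip der br H vmult nabla"
  shows "cochain_complex (cochain_scale scale vmult)
           (cochains scale smult ip der H vmult)
           (differential br H vmult nabla)"
proof -
  interpret H_cochains scale smult ip der br H vmult nabla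
    using assms by (intro H_cochains.intro H_cochains_axioms.intro)
  show ?thesis by (rule cochain_complex_C)
qed

end
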